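(* Let $d\geq 3$ be an integer and let $\tau,\tau^{*},\tau^{\varepsilon}\in\mathbb{K}$. Then the following (i), (ii) are equivalent. (i) There exists a totally almost bipartite Leonard triple $A,A^{*},A^{\varepsilon}$ of Bannai/Ito type with diameter $d$, $\mathrm{tr}(A)=\tau$, $\mathrm{tr}(A^{*})=\tau^{*}$ and $\mathrm{tr}(A^{\varepsilon})=\tau^{\varepsilon}$. (ii) The scalars $\tau,\tau^{*},\tau^{\varepsilon}$ are nonzero. Moreover, if (i), (ii) hold, then the Leonard triple in (i) is unique up to isomorphism of Leonard triples.
   Context: $\mathbb{K}$ is an algebraically closed field of characteristic zero. A square matrix is tridiagonal if every nonzero entry lies on the diagonal, subdiagonal or superdiagonal; a tridiagonal matrix is irreducible if every subdiagonal and superdiagonal entry is nonzero. A tridiagonal matrix $B$ with rows and columns indexed by $0,\dots,d$ is almost bipartite if exactly one of $B_{00},B_{dd}$ is nonzero and $B_{ii}=0$ for $1\le i\le d-1$. Let $V$ be a $\mathbb{K}$-vector space of finite positive dimension. A Leonard pair on $V$ is an ordered pair of linear maps $A,A^*:V\to V$ such that there is a basis $\{v_i\}_{i=0}^d$ of $V$ in which $A$ is diagonal and $A^*$ is irreducible tridiagonal, and a basis $\{v^*_i\}_{i=0}^d$ in which $A^*$ is diagonal and $A$ is irreducible tridiagonal. With $\theta_i$ the eigenvalue of $A$ for $v_i$ and $\theta_i^*$ the eigenvalue of $A^*$ for $v_i^*$, it is known that the expressions $\frac{\theta_{i-2}-\theta_{i+1}}{\theta_{i-1}-\theta_i}$,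 $\frac{\theta^*_{i-2}-\theta^*_{i+1}}{\theta^*_{i-1}-\theta^*_i}$ are equal and independent of $i$ for $2\le i\le d-1$; the Leonard pair is of Bannai/Ito type if this common value is $-1$. A Leonard triple on $V$ is an ordered triple of linear maps $A,A^*,A^\varepsilon:V\to V$ such that for each of the three maps there is a basis of $V$ in which that map is diagonal and the other two are irreducible tridiagonal. Its diameter is $\dim V-1$. It is totally almost bipartite if all six tridiagonal matrices so arising are almost bipartite. Any two of the three maps (in either order) form a Leonard pair; the triple is of Bannai/Ito type if all these Leonard pairs are. Leonard triples $A,A^*,A^\varepsilon$ on $V$ and $B,B^*,B^\varepsilon$ on $W$ are isomorphic if there is a vector space isomorphism $\phi:V\to W$ with $\phi A=B\phi$, $\phi A^*=B^*\phi$, $\phi A^\varepsilon=B^\varepsilon\phi$. *)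

theory Defs
  imports
    "HOL-Computational_Algebra.Polynomial"
    "Jordan_Normal_Form.Matrix"
begin

definition tridiagonal_mat :: "'k::zero mat \<Rightarrow> bool" where
  "tridiagonal_mat B \<longleftrightarrow>
     (\<forall>i<dim_row B. \<forall>j<dim_col B. B $$ (i, j) \<noteq> 0 \<longrightarrow> i = j \<or> i = Suc j \<or> j = Suc i)"

definition irreducible_tridiagonal_mat :: "'k::zero mat \<Rightarrow> bool" where
  "irreducible_tridiagonal_mat B \<longleftrightarrow> square_mat B \<and> tridiagonal_mat B \<and>
     (\<forall>i. Suc i < dim_row B \<longrightarrow> B $$ (Suc i, i) \<noteq> 0 \<and> B $$ (i, Suc i) \<noteq> 0)"

definition almost_bipartite_mat :: "'k::zero mat \<Rightarrow> bool" where
  "almost_bipartite_mat B \<longleftrightarrow> square_mat B \<and> tridiagonal_mat B \<and>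
     (B $$ (0, 0) \<noteq> 0) \<noteq> (B $$ (dim_row B - 1, dim_row B - 1) \<noteq> 0) \<and>
     (\<forall>i. 1 \<le> i \<and> Suc i < dim_row B \<longrightarrow> B $$ (i, i) = 0)"

text \<open>
  A vector space is represented by a subspace \<open>V\<close> of an ambient vector space, so that spaces of
  dimension \<open>d + 1\<close> with \<open>d\<close> a variable can be quantified over; a type that is itself a vector
  space is the case \<open>V = UNIV\<close>. A linear map on \<open>V\<close> is a function on the ambient type whose
  values outside \<open>V\<close> are never looked at. For existence statements, the polynomials with
  \<open>smult\<close> serve as ambient space: every space of dimension \<open>d + 1\<close> is isomorphic to a
  subspace of it, namely the polynomials of degree at most \<open>d\<close>.
\<close>

definition linear_map_on ::
  "('k::field \<Rightarrow> 'v::ab_group_add \<Rightarrow> 'v) \<Rightarrow>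
    ('k \<Rightarrow> 'w::ab_group_add \<Rightarrow> 'w) \<Rightarrow>
    'v set \<Rightarrow> 'w set \<Rightarrow> ('v \<Rightarrow> 'w) \<Rightarrow> bool" where
  "linear_map_on s t V W f \<longleftrightarrow>
     (\<forall>x\<in>V. f x \<in> W) \<and>
     (\<forall>x\<in>V. \<forall>y\<in>V. f (x + y) = f x + f y) \<and>
     (\<forall>c. \<forall>x\<in>V. f (s c x) = t c (f x))"

definition fin_dim_pos ::
  "('k::field \<Rightarrow> 'v::ab_group_add \<Rightarrow> 'v) \<Rightarrow>
    'v set \<Rightarrow> bool" where
  "fin_dim_pos s V \<longleftrightarrow> module.subspace s V \<and> (\<exists>B. finite B \<and> module.span s B = V) \<and> V \<noteq> {0}"

definition diam ::
  "('k::field \<Rightarrow> 'v::ab_group_add \<Rightarrow> 'v) \<Rightarrow>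
    'v set \<Rightarrow> nat" where
  "diam s V = vector_space.dim s V - 1"

text \<open>Only the values \<open>v 0, \<dots>, v d\<close> matter, where \<open>d = diam s V\<close>.\<close>

definition ordered_basis ::
  "('k::field \<Rightarrow> 'v::ab_group_add \<Rightarrow> 'v) \<Rightarrow>
    'v set \<Rightarrow> (nat \<Rightarrow> 'v) \<Rightarrow> bool" where
  "ordered_basis s V v \<longleftrightarrow>
     inj_on v {..diam s V} \<and> \<not> module.dependent s (v ` {..diam s V}) \<and>
     module.span s (v ` {..diam s V}) = V"

text \<open>The matrix \<open>B\<close> with \<open>A v\<^sub>j = (\<Sum>i\<le>d. B\<^sub>i\<^sub>j v\<^sub>i)\<close>.\<close>

definition matrix_of ::
  "('k::field \<Rightarrow> 'v::ab_group_add \<Rightarrow> 'v) \<Rightarrow>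
    'v set \<Rightarrow> (nat \<Rightarrow> 'v) \<Rightarrow> ('v \<Rightarrow> 'v) \<Rightarrow> 'k mat" where
  "matrix_of s V v A =
     mat (Suc (diam s V)) (Suc (diam s V))
       (\<lambda>(i, j). module.representation s (v ` {..diam s V}) (A (v j)) (v i))"

text \<open>The trace does not depend on the basis chosen.\<close>

definition trace_on ::
  "('k::field \<Rightarrow> 'v::ab_group_add \<Rightarrow> 'v) \<Rightarrow>
    'v set \<Rightarrow> ('v \<Rightarrow> 'v) \<Rightarrow> 'k" where
  "trace_on s V A =
     (let B = matrix_of s V (SOME v. ordered_basis s V v) A in \<Sum>i<dim_row B. B $$ (i, i))"

definition leonard_basis ::
  "('k::field \<Rightarrow> 'v::ab_group_add \<Rightarrow> 'v) \<Rightarrow>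
    'v set \<Rightarrow> (nat \<Rightarrow> 'v) \<Rightarrow> ('v \<Rightarrow> 'v) \<Rightarrow> ('v \<Rightarrow> 'v) \<Rightarrow> bool" where
  "leonard_basis s V v A B \<longleftrightarrow> ordered_basis s V v \<and>
     diagonal_mat (matrix_of s V v A) \<and> irreducible_tridiagonal_mat (matrix_of s V v B)"

definition leonard_pair ::
  "('k::field \<Rightarrow> 'v::ab_group_add \<Rightarrow> 'v) \<Rightarrow>
    'v set \<Rightarrow> ('v \<Rightarrow> 'v) \<Rightarrow> ('v \<Rightarrow> 'v) \<Rightarrow> bool" where
  "leonard_pair s V A A' \<longleftrightarrow> fin_dim_pos s V \<and>
     linear_map_on s s V V A \<and> linear_map_on s s V V A' \<and>
     (\<exists>v. leonard_basis s V v A A') \<and> (\<exists>v'. leonard_basis s V v' A' A)"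

text \<open>
  The orderings of the eigenvalues \<open>\<theta>\<^sub>i\<close> of \<open>A\<close> and \<open>\<theta>'\<^sub>i\<close> of \<open>A'\<close> come from bases as in
  the definition of a Leonard pair. Such a basis is unique up to rescaling its members and
  reversing their order, and reversal carries the quotient at \<open>i\<close> to the one at \<open>d + 1 - i\<close>,
  so it is immaterial which bases are used. The type is only defined for diameter at least 3, where the
  range of \<open>i\<close> is nonempty.
\<close>

definition bannai_ito_pair ::
  "('k::field \<Rightarrow> 'v::ab_group_add \<Rightarrow> 'v) \<Rightarrow>
    'v set \<Rightarrow> ('v \<Rightarrow> 'v) \<Rightarrow> ('v \<Rightarrow> 'v) \<Rightarrow> bool" where
  "bannai_ito_pair s V A A' \<longleftrightarrow> leonard_pair s V A A' \<and> diam s V \<ge> 3 \<and>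
     (\<exists>v v'. leonard_basis s V v A A' \<and> leonard_basis s V v' A' A \<and>
       (let \<theta> = (\<lambda>i. matrix_of s V v A $$ (i, i)); \<theta>' = (\<lambda>i. matrix_of s V v' A' $$ (i, i)) in
        \<forall>i. 2 \<le> i \<and> i \<le> diam s V - 1 \<longrightarrow>
          (\<theta> (i - 2) - \<theta> (i + 1)) / (\<theta> (i - 1) - \<theta> i) = -1 \<and>
          (\<theta>' (i - 2) - \<theta>' (i + 1)) / (\<theta>' (i - 1) - \<theta>' i) = -1))"

definition leonard_triple ::
  "('k::field \<Rightarrow> 'v::ab_group_add \<Rightarrow> 'v) \<Rightarrow>
    'v set \<Rightarrow> ('v \<Rightarrow> 'v) \<Rightarrow> ('v \<Rightarrow> 'v) \<Rightarrow> ('v \<Rightarrow> 'v) \<Rightarrow> bool" where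
  "leonard_triple s V A A' A'' \<longleftrightarrow> fin_dim_pos s V \<and>
     linear_map_on s s V V A \<and> linear_map_on s s V V A' \<and>
     linear_map_on s s V V A'' \<and>
     (\<exists>v. leonard_basis s V v A A' \<and> leonard_basis s V v A A'') \<and>
     (\<exists>v. leonard_basis s V v A' A'' \<and> leonard_basis s V v A' A) \<and>
     (\<exists>v. leonard_basis s V v A'' A \<and> leonard_basis s V v A'' A')"

text \<open>
  The quantification is over all bases that can arise in the definition of a Leonard triple. Since
  they are unique up to rescaling and reversal, which preserve almost bipartiteness, it would make
  no difference to ask for one basis for each of the three maps.
\<close>

definition totally_almost_bipartite ::
  "('k::field \<Rightarrow> 'v::ab_group_add \<Rightarrow> 'v) \<Rightarrow>
    'v set \<Rightarrow> ('v \<Rightarrow> 'v) \<Rightarrow> ('v \<Rightarrow> 'v) \<Rightarrow> ('v \<Rightarrow> 'v) \<Rightarrow> bool" where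
  "totally_almost_bipartite s V A A' A'' \<longleftrightarrow> leonard_triple s V A A' A'' \<and>
     (\<forall>(X, Y, Z) \<in> {(A, A', A''), (A', A'', A), (A'', A, A')}.
       \<forall>v. leonard_basis s V v X Y \<and> leonard_basis s V v X Z \<longrightarrow>
         almost_bipartite_mat (matrix_of s V v Y) \<and> almost_bipartite_mat (matrix_of s V v Z))"

definition bannai_ito_triple ::
  "('k::field \<Rightarrow> 'v::ab_group_add \<Rightarrow> 'v) \<Rightarrow>
    'v set \<Rightarrow> ('v \<Rightarrow> 'v) \<Rightarrow> ('v \<Rightarrow> 'v) \<Rightarrow> ('v \<Rightarrow> 'v) \<Rightarrow> bool" where
  "bannai_ito_triple s V A A' A'' \<longleftrightarrow> leonard_triple s V A A' A'' \<and>
     bannai_ito_pair s V A A' \<and> bannai_ito_pair s V A' A \<and>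
     bannai_ito_pair s V A A'' \<and> bannai_ito_pair s V A'' A \<and>
     bannai_ito_pair s V A' A'' \<and> bannai_ito_pair s V A'' A'"

definition tab_bannai_ito_triple ::
  "('k::field \<Rightarrow> 'v::ab_group_add \<Rightarrow> 'v) \<Rightarrow>
    nat \<Rightarrow> 'k \<Rightarrow> 'k \<Rightarrow> 'k \<Rightarrow> 'v set \<Rightarrow> ('v \<Rightarrow> 'v) \<Rightarrow> ('v \<Rightarrow> 'v) \<Rightarrow> ('v \<Rightarrow> 'v) \<Rightarrow> bool" where
  "tab_bannai_ito_triple s d \<tau> \<tau>' \<tau>'' V A A' A'' \<longleftrightarrow>
     totally_almost_bipartite s V A A' A'' \<and> bannai_ito_triple s V A A' A'' \<and> diam s V = d \<and>
     trace_on s V A = \<tau> \<and> trace_on s V A' = \<tau>' \<and> trace_on s V A'' = \<tau>''"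

definition isomorphic_triples ::
  "('k::field \<Rightarrow> 'v::ab_group_add \<Rightarrow> 'v) \<Rightarrow>
    'v set \<Rightarrow> ('v \<Rightarrow> 'v) \<Rightarrow> ('v \<Rightarrow> 'v) \<Rightarrow> ('v \<Rightarrow> 'v) \<Rightarrow>
   ('k \<Rightarrow> 'w::ab_group_add \<Rightarrow> 'w) \<Rightarrow> 'w set \<Rightarrow> ('w \<Rightarrow> 'w) \<Rightarrow> ('w \<Rightarrow> 'w) \<Rightarrow> ('w \<Rightarrow> 'w) \<Rightarrow> bool" where
  "isomorphic_triples s V A A' A'' t W B B' B'' \<longleftrightarrow>
     (\<exists>\<phi>. linear_map_on s t V W \<phi> \<and> bij_betw \<phi> V W \<and>
        (\<forall>x\<in>V. \<phi> (A x) = B (\<phi> x) \<and> \<phi> (A' x) = B' (\<phi> x) \<and> \<phi> (A'' x) = B'' (\<phi> x)))"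

end

theory Submission
  imports Defs
begin

text \<open>
  Write \<open>v\<close>, \<open>w\<close> for the bases that diagonalise \<open>A\<close> and \<open>A\<^sup>*\<close>, ordered so that the nonzero diagonal
  entry of the other map sits at index \<open>0\<close>, and let \<open>p\<close>, \<open>q\<close> be the two values taken alternately by
  \<open>\<theta>\<^sub>i + \<theta>\<^sub>i\<^sub>+\<^sub>1\<close> in Bannai/Ito type. The operator
  \<open>A\<^sup>2A\<^sup>* + 2AA\<^sup>*A + A\<^sup>*A\<^sup>2 - (p + q)(AA\<^sup>* + A\<^sup>*A) + pqA\<^sup>*\<close> has rank at most one because \<open>A\<^sup>*\<close> is almost
  bipartite, and it is pentadiagonal in the basis \<open>w\<close>; for \<open>d \<ge> 3\<close> this forces it to vanish.
  Comparing entries gives \<open>\<theta>\<^sub>i = (-1)\<^sup>i(2i + 1)\<theta>\<^sub>0\<close> and \<open>A\<^sup>2A\<^sup>* + 2AA\<^sup>*A + A\<^sup>*A\<^sup>2 = 4\<theta>\<^sub>0\<^sup>2A\<^sup>*\<close>, likewise for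
  every other pair from the triple. These relations fix all three matrices in the basis \<open>v\<close>, up to
  rescaling \<open>v\<close>, in terms of the traces, and each trace is a single nonzero entry.

  Conversely, maps with \<open>XY + YX = Z\<close>, \<open>YZ + ZY = X\<close>, \<open>ZX + XZ = Y\<close> and scalar \<open>X\<^sup>2 + Y\<^sup>2 + Z\<^sup>2\<close> form such a
  triple as soon as each has the eigenvalue \<open>\<plusminus>(d + 1/2)\<close>, and arbitrary traces are reached by rescaling
  \<open>X\<close>, \<open>Y\<close>, \<open>Z\<close>.
\<close>

section \<open>Coordinates and tridiagonal matrices\<close>

text \<open>The operator comes from the polynomial (x + y - p)(x + y - q): in an eigenbasis of A its
  (i, j) entry is the value at x = \<open>\<theta>\<^sub>i\<close>, y =
  \<open>\<theta>\<^sub>j\<close>, times the entry of the other map. Between neighbours the value is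
  0, and on the diagonal the entry of the other map is 0 except at one end. Two obstacles shape the
  rest of the uniqueness proof. Every pair orients the eigenbasis on its own, while the canonical
  matrices need one orientation for both other maps; the eigenvalues provide it, because their
  absolute values grow away from index 0, so that a reversal destroys their form. Moreover, the
  relations with A determine only products of opposite off-diagonal entries. For the second map,
  rescaling the basis removes this ambiguity; for the third map no freedom is left, and its
  individual entries have to be extracted from its relation with the second map.\<close>

locale fin_space = vector_space s
  for s :: "'k::field \<Rightarrow> 'v::ab_group_add \<Rightarrow> 'v" (infixr \<open>*s\<close> 75) +
  fixes V :: "'v set" and d :: nat
  assumes ex_basis: "\<exists>v. inj_on v {..d} \<and> independent (v ` {..d}) \<and> span (v ` {..d}) = V"
begin

definition basis :: "(nat \<Rightarrow> 'v) \<Rightarrow> bool" where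
  "basis v \<longleftrightarrow> inj_on v {..d} \<and> independent (v ` {..d}) \<and> span (v ` {..d}) = V"

definition crd :: "(nat \<Rightarrow> 'v) \<Rightarrow> nat \<Rightarrow> 'v \<Rightarrow> 'k" where
  "crd v i x = representation (v ` {..d}) x (v i)"

definition mx :: "(nat \<Rightarrow> 'v) \<Rightarrow> ('v \<Rightarrow> 'v) \<Rightarrow> nat \<Rightarrow> nat \<Rightarrow> 'k" where
  "mx v F i j = crd v i (F (v j))"

abbreviation "lin \<equiv> linear_map_on s s V V"

lemma subspace_V: "subspace V"
  using ex_basis by (metis subspace_span)

lemma V_add [simp]: "x \<in> V \<Longrightarrow> y \<in> V \<Longrightarrow> x + y \<in> V"
  and V_diff [simp]: "x \<in> V \<Longrightarrow> y \<in> V \<Longrightarrow> x - y \<in> V"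
  and V_scale [simp]: "x \<in> V \<Longrightarrow> c *s x \<in> V"
  and V_zero [simp]: "0 \<in> V"
  using subspace_V by (auto intro: subspace_add subspace_diff subspace_scale subspace_0)

lemma V_sum [simp]: "(\<And>i. i \<in> I \<Longrightarrow> f i \<in> V) \<Longrightarrow> sum f I \<in> V"
  using subspace_V by (rule subspace_sum)

lemma dim_V: "dim V = Suc d"
  using ex_basis by (metis card_atMost card_image dim_span_eq_card_independent)

lemma diam_V: "diam s V = d"
  by (simp add: diam_def dim_V)

lemma ordered_basis_iff: "ordered_basis s V v \<longleftrightarrow> basis v"
  by (simp add: ordered_basis_def basis_def diam_V)

lemma basis_in [simp]: "basis v \<Longrightarrow> i \<le> d \<Longrightarrow> v i \<in> V"
  unfolding basis_def by (metis atMost_iff image_eqI span_base)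

lemma crd_add [simp]: "basis v \<Longrightarrow> x \<in> V \<Longrightarrow> y \<in> V \<Longrightarrow> crd v i (x + y) = crd v i x + crd v i y"
  and crd_diff [simp]: "basis v \<Longrightarrow> x \<in> V \<Longrightarrow> y \<in> V \<Longrightarrow> crd v i (x - y) = crd v i x - crd v i y"
  and crd_scale [simp]: "basis v \<Longrightarrow> x \<in> V \<Longrightarrow> crd v i (c *s x) = c * crd v i x"
  by (auto simp: crd_def basis_def representation_add representation_diff representation_scale)

lemma crd_zero [simp]: "crd v i 0 = 0"
  by (simp add: crd_def representation_zero)

lemma crd_sum [simp]: "basis v \<Longrightarrow> (\<And>j. j \<in> I \<Longrightarrow> f j \<in> V) \<Longrightarrow> crd v i (sum f I) = (\<Sum>j\<in>I. crd v i (f j))"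
  by (simp add: crd_def basis_def representation_sum)

lemma crd_basis [simp]: "basis v \<Longrightarrow> i \<le> d \<Longrightarrow> j \<le> d \<Longrightarrow> crd v i (v j) = (if i = j then 1 else 0)"
  by (auto simp: crd_def basis_def representation_basis inj_on_eq_iff)

lemma basis_expand: "basis v \<Longrightarrow> x \<in> V \<Longrightarrow> (\<Sum>i\<le>d. crd v i x *s v i) = x"
  using sum_representation_eq[of "v ` {..d}" x "v ` {..d}"]
  by (simp add: crd_def basis_def sum.reindex)

lemma crd_comb: "basis v \<Longrightarrow> i \<le> d \<Longrightarrow> crd v i (\<Sum>j\<le>d. c j *s v j) = c i"
  by (subst crd_sum) (simp_all add: if_distrib[where f="\<lambda>x. _ * x"] cong: if_cong)

lemma crd_eqI: "basis v \<Longrightarrow> x \<in> V \<Longrightarrow> y \<in> V \<Longrightarrow> (\<And>i. i \<le> d \<Longrightarrow> crd v i x = crd v i y) \<Longrightarrow> x = y"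
  by (metis (no_types, lifting) atMost_iff basis_expand sum.cong)

lemma lin_in [simp]: "lin F \<Longrightarrow> x \<in> V \<Longrightarrow> F x \<in> V"
  and lin_add: "lin F \<Longrightarrow> x \<in> V \<Longrightarrow> y \<in> V \<Longrightarrow> F (x + y) = F x + F y"
  and lin_scale: "lin F \<Longrightarrow> x \<in> V \<Longrightarrow> F (c *s x) = c *s F x"
  by (auto simp: linear_map_on_def)

lemma lin_zero: "lin F \<Longrightarrow> F 0 = 0"
  using lin_scale[of F 0 0] by simp

lemma lin_sum: "lin F \<Longrightarrow> (\<And>i. i \<in> I \<Longrightarrow> f i \<in> V) \<Longrightarrow> F (sum f I) = (\<Sum>i\<in>I. F (f i))"
  by (induction I rule: infinite_finite_induct) (auto simp: lin_zero lin_add)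

lemma lin_diff: "lin F \<Longrightarrow> x \<in> V \<Longrightarrow> y \<in> V \<Longrightarrow> F (x - y) = F x - F y"
  by (metis V_diff add_diff_cancel_right' diff_add_cancel lin_add)

lemma lin_comb: "lin F \<Longrightarrow> basis v \<Longrightarrow> x \<in> V \<Longrightarrow> F x = (\<Sum>j\<le>d. crd v j x *s F (v j))"
  using lin_sum[of F "{..d}" "\<lambda>j. crd v j x *s v j"]
  by (simp add: basis_expand lin_scale)

lemma crd_apply:
  "lin F \<Longrightarrow> basis v \<Longrightarrow> x \<in> V \<Longrightarrow> crd v i (F x) = (\<Sum>j\<le>d. mx v F i j * crd v j x)"
  by (subst lin_comb[of F v x], assumption+, subst crd_sum) (simp_all add: mx_def mult.commute)

text \<open>Independence is required of the indexed family, which also excludes repetitions.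
  Spanning then follows by counting: d + 2 independent vectors do not fit into
  \<open>V\<close>.\<close>

lemma basisI:
  assumes "\<And>i. i \<le> d \<Longrightarrow> v i \<in> V"
    and ind: "\<And>c. (\<Sum>i\<le>d. c i *s v i) = 0 \<Longrightarrow> \<forall>i\<le>d. c i = 0"
  shows "basis v"
proof -
  have inj: "inj_on v {..d}"
  proof (rule inj_onI, rule ccontr)
    fix i j assume ij: "i \<in> {..d}" "j \<in> {..d}" "v i = v j" "i \<noteq> j"
    define c :: "nat \<Rightarrow> 'k" where "c k = (if k = i then 1 else if k = j then -1 else 0)" for k
    have "(\<Sum>k\<le>d. c k *s v k) = (\<Sum>k\<in>{i, j}. c k *s v k)"
      using ij by (intro sum.mono_neutral_right) (auto simp: c_def)
    also have "\<dots> = 0" using ij by (simp add: c_def)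
    finally have "c i = 0" using ind[of c] ij by simp
    then show False by (simp add: c_def)
  qed
  have indep: "independent (v ` {..d})"
  proof (rule independent_if_scalars_zero)
    fix f x assume "(\<Sum>x\<in>v ` {..d}. f x *s x) = 0" "x \<in> v ` {..d}"
    then show "f x = 0" using ind[of "\<lambda>i. f (v i)"] inj by (auto simp: sum.reindex)
  qed simp
  have "V \<subseteq> span (v ` {..d})"
  proof (rule ccontr)
    assume "\<not> V \<subseteq> span (v ` {..d})"
    then obtain x where x: "x \<in> V" "x \<notin> span (v ` {..d})" by blast
    obtain w where w: "span (w ` {..d}) = V" using ex_basis by blast
    have "independent (insert x (v ` {..d}))"
      using indep x by (simp add: independent_insert)
    moreover have "insert x (v ` {..d}) \<subseteq> span (w ` {..d})" using assms(1) x w by auto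
    ultimately have "card (insert x (v ` {..d})) \<le> card (w ` {..d})"
      using independent_span_bound[of "w ` {..d}"] by blast
    moreover have "card (insert x (v ` {..d})) = Suc (Suc d)"
    proof -
      have "x \<notin> v ` {..d}" using x(2) span_base by metis
      then show ?thesis using inj by (simp add: card_image)
    qed
    moreover have "card (w ` {..d}) \<le> Suc d" by (metis card_atMost card_image_le finite_atMost)
    ultimately show False by simp
  qed
  moreover have "span (v ` {..d}) \<subseteq> V"
    using assms(1) subspace_V by (intro span_minimal) auto
  ultimately show ?thesis using inj indep unfolding basis_def by blast
qed

text \<open>Two eigenbases of a map without repeated eigenvalues differ by exactly such a change,
  see \<open>eigenbasis_unique\<close>. Reversal of the order and normalisation of a subdiagonal are
  the special cases used later.\<close>

lemma basis_scale_permute: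
  assumes v: "basis v" and p: "bij_betw p {..d} {..d}" and c: "\<And>i. i \<le> d \<Longrightarrow> c i \<noteq> 0"
    and u: "\<And>i. i \<le> d \<Longrightarrow> u i = c i *s v (p i)"
  shows "basis u"
proof (rule basisI)
  have p_le: "i \<le> d \<Longrightarrow> p i \<le> d" for i using p by (auto simp: bij_betw_def)
  show "u i \<in> V" if "i \<le> d" for i using that by (simp add: u v p_le)
  fix a assume "(\<Sum>i\<le>d. a i *s u i) = 0"
  then have sum: "(\<Sum>i\<le>d. (a i * c i) *s v (p i)) = 0" by (simp add: u)
  show "\<forall>i\<le>d. a i = 0"
  proof (intro allI impI)
    fix i assume i: "i \<le> d"
    have "0 = crd v (p i) (\<Sum>i\<le>d. (a i * c i) *s v (p i))"
      by (simp only: sum crd_zero)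
    also have "\<dots> = (\<Sum>k\<le>d. if i = k then a k * c k else 0)"
      using v p i p_le by (subst crd_sum) (auto intro!: sum.cong simp: bij_betw_def inj_on_eq_iff if_distrib[where f="\<lambda>x. _ * x"] cong: if_cong)
    also have "\<dots> = a i * c i" using i by simp
    finally show "a i = 0" using c i by simp
  qed
qed

lemma crd_scale_permute:
  assumes v: "basis v" and p: "bij_betw p {..d} {..d}" and c: "\<And>i. i \<le> d \<Longrightarrow> c i \<noteq> 0"
    and u: "\<And>i. i \<le> d \<Longrightarrow> u i = c i *s v (p i)" and x: "x \<in> V" and i: "i \<le> d"
  shows "crd v (p i) x = c i * crd u i x"
proof -
  have p_le: "i \<le> d \<Longrightarrow> p i \<le> d" for i using p by (auto simp: bij_betw_def)
  have bu: "basis u" using basis_scale_permute[OF v p c u] by blast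
  have "crd v (p i) x = crd v (p i) (\<Sum>k\<le>d. crd u k x *s u k)"
    using bu x by (simp add: basis_expand)
  also have "\<dots> = (\<Sum>k\<le>d. if i = k then c i * crd u i x else 0)"
    using v p i p_le bu by (subst crd_sum) (auto intro!: sum.cong simp: bij_betw_def inj_on_eq_iff u if_distrib[where f="\<lambda>x. _ * x"] cong: if_cong)
  finally show ?thesis using i by simp
qed

lemma mx_scale_permute:
  assumes v: "basis v" and p: "bij_betw p {..d} {..d}" and c: "\<And>i. i \<le> d \<Longrightarrow> c i \<noteq> 0"
    and u: "\<And>i. i \<le> d \<Longrightarrow> u i = c i *s v (p i)" and F: "lin F" and ij: "i \<le> d" "j \<le> d"
  shows "mx u F i j = c j / c i * mx v F (p i) (p j)"
proof -
  have p_le: "i \<le> d \<Longrightarrow> p i \<le> d" for i using p by (auto simp: bij_betw_def)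
  have bu: "basis u" using basis_scale_permute[OF v p c u] by blast
  have "crd v (p i) (F (u j)) = c i * mx u F i j"
    unfolding mx_def using bu F ij by (intro crd_scale_permute[OF v p c u]) auto
  moreover have "crd v (p i) (F (u j)) = c j * mx v F (p i) (p j)"
    using v F ij p_le by (simp add: u mx_def lin_scale)
  ultimately show ?thesis using c[of i] ij by (simp add: field_simps)
qed

text \<open>\<open>trace_on\<close> takes the matrix in a basis chosen by \<open>SOME\<close>. The
  double sum of \<open>crd u i (v j) * crd v j (F (u i))\<close> is the trace in \<open>u\<close> or
  in \<open>v\<close>, depending on which index is summed first.\<close>

lemma trace_eq:
  assumes v: "basis v" and F: "lin F"
  shows "trace_on s V F = (\<Sum>i\<le>d. mx v F i i)"
proof -
  define u where "u = (SOME v. ordered_basis s V v)"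
  have u: "basis u"
    using someI[of "ordered_basis s V" v] v unfolding u_def ordered_basis_iff by blast
  have "trace_on s V F = (\<Sum>i\<le>d. mx u F i i)"
    unfolding trace_on_def u_def[symmetric] Let_def
    by (simp add: matrix_of_def diam_V mx_def crd_def lessThan_Suc_atMost)
  also have "\<dots> = (\<Sum>i\<le>d. \<Sum>j\<le>d. crd u i (v j) * crd v j (F (u i)))"
  proof (rule sum.cong)
    fix i assume "i \<in> {..d}"
    then show "mx u F i i = (\<Sum>j\<le>d. crd u i (v j) * crd v j (F (u i)))"
      using basis_expand[OF v, of "F (u i)"] crd_sum[OF u, of "{..d}" "\<lambda>j. crd v j (F (u i)) *s v j" i] u v F
      by (simp add: mx_def mult.commute)
  qed simp
  also have "\<dots> = (\<Sum>j\<le>d. \<Sum>i\<le>d. crd v j (F (u i)) * crd u i (v j))"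
    by (subst sum.swap) (simp add: mult.commute)
  also have "\<dots> = (\<Sum>j\<le>d. mx v F j j)"
  proof (rule sum.cong)
    fix j assume "j \<in> {..d}"
    then show "(\<Sum>i\<le>d. crd v j (F (u i)) * crd u i (v j)) = mx v F j j"
      using u v F unfolding mx_def
      by (subst (2) lin_comb[OF F u]) (simp, subst crd_sum, auto simp: mult.commute)
  qed simp
  finally show ?thesis .
qed

section \<open>Diagonal and irreducible tridiagonal maps in coordinates\<close>

definition diag_in :: "(nat \<Rightarrow> 'v) \<Rightarrow> ('v \<Rightarrow> 'v) \<Rightarrow> (nat \<Rightarrow> 'k) \<Rightarrow> bool" where
  "diag_in v F \<theta> \<longleftrightarrow> (\<forall>i\<le>d. F (v i) = \<theta> i *s v i)"

definition irred :: "(nat \<Rightarrow> 'v) \<Rightarrow> ('v \<Rightarrow> 'v) \<Rightarrow> bool" where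
  "irred v F \<longleftrightarrow> (\<forall>i\<le>d. \<forall>j\<le>d. mx v F i j \<noteq> 0 \<longrightarrow> i = j \<or> i = Suc j \<or> j = Suc i) \<and>
     (\<forall>i<d. mx v F (Suc i) i \<noteq> 0 \<and> mx v F i (Suc i) \<noteq> 0)"

lemma matrix_of_index: "i \<le> d \<Longrightarrow> j \<le> d \<Longrightarrow> matrix_of s V v F $$ (i, j) = mx v F i j"
  by (simp add: matrix_of_def diam_V mx_def crd_def)

lemma matrix_of_dim: "dim_row (matrix_of s V v F) = Suc d" "dim_col (matrix_of s V v F) = Suc d"
  by (auto simp: matrix_of_def diam_V)

lemma leonard_basis_iff:
  assumes "lin A"
  shows "leonard_basis s V v A B \<longleftrightarrow> basis v \<and> diag_in v A (\<lambda>i. mx v A i i) \<and> irred v B"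
proof -
  have "diagonal_mat (matrix_of s V v A) \<longleftrightarrow> diag_in v A (\<lambda>i. mx v A i i)" if v: "basis v"
  proof -
    have "diagonal_mat (matrix_of s V v A) \<longleftrightarrow> (\<forall>i\<le>d. \<forall>j\<le>d. i \<noteq> j \<longrightarrow> mx v A i j = 0)"
      by (simp add: diagonal_mat_def matrix_of_dim less_Suc_eq_le matrix_of_index)
    also have "\<dots> \<longleftrightarrow> diag_in v A (\<lambda>i. mx v A i i)"
    proof
      assume h: "\<forall>i\<le>d. \<forall>j\<le>d. i \<noteq> j \<longrightarrow> mx v A i j = 0"
      show "diag_in v A (\<lambda>i. mx v A i i)"
        unfolding diag_in_def
      proof (intro allI impI)
        fix j assume j: "j \<le> d"
        show "A (v j) = mx v A j j *s v j"
        proof (rule crd_eqI[OF v])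
          show "crd v i (A (v j)) = crd v i (mx v A j j *s v j)" if "i \<le> d" for i
            using h j that v by (cases "i = j") (auto simp: mx_def assms)
        qed (use assms v j in auto)
      qed
    next
      assume "diag_in v A (\<lambda>i. mx v A i i)"
      then show "\<forall>i\<le>d. \<forall>j\<le>d. i \<noteq> j \<longrightarrow> mx v A i j = 0"
        using v assms unfolding diag_in_def by (metis basis_in crd_basis crd_scale mult_zero_right mx_def)
    qed
    finally show ?thesis .
  qed
  moreover have "irreducible_tridiagonal_mat (matrix_of s V v B) \<longleftrightarrow> irred v B"
    by (simp add: irreducible_tridiagonal_mat_def tridiagonal_mat_def irred_def matrix_of_dim
        less_Suc_eq_le matrix_of_index Suc_le_eq)
  ultimately show ?thesis by (auto simp: leonard_basis_def ordered_basis_iff)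
qed

lemma diag_in_mx: "basis v \<Longrightarrow> diag_in v A \<theta> \<Longrightarrow> i \<le> d \<Longrightarrow> j \<le> d \<Longrightarrow> mx v A i j = (if i = j then \<theta> i else 0)"
  by (simp add: mx_def diag_in_def)

lemma crd_diag:
  assumes "lin A" "basis v" "diag_in v A \<theta>" "x \<in> V" "i \<le> d"
  shows "crd v i (A x) = \<theta> i * crd v i x"
  using assms by (simp add: crd_apply diag_in_mx if_distrib[where f="\<lambda>x. x * _"] cong: if_cong)

lemma irred_far: "irred v F \<Longrightarrow> i \<le> d \<Longrightarrow> j \<le> d \<Longrightarrow> i \<noteq> j \<Longrightarrow> i \<noteq> Suc j \<Longrightarrow> j \<noteq> Suc i \<Longrightarrow> mx v F i j = 0"
  unfolding irred_def by blast

lemma sum_tridiag_row: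
  assumes "irred v F" "i \<le> d"
  shows "(\<Sum>k\<le>d. mx v F i k * g k) =
    (if i = 0 then 0 else mx v F i (i - 1) * g (i - 1)) + mx v F i i * g i +
    (if i = d then 0 else mx v F i (Suc i) * g (Suc i))"
proof -
  let ?S = "(if i = 0 then {} else {i - 1}) \<union> {i} \<union> (if i = d then {} else {Suc i})"
  have "(\<Sum>k\<le>d. mx v F i k * g k) = (\<Sum>k\<in>?S. mx v F i k * g k)"
    using assms by (intro sum.mono_neutral_right) (auto simp: irred_far split: if_splits)
  also have "\<dots> = (if i = 0 then 0 else mx v F i (i - 1) * g (i - 1)) + mx v F i i * g i +
    (if i = d then 0 else mx v F i (Suc i) * g (Suc i))"
    by (auto simp: algebra_simps)
  finally show ?thesis .
qed

end

section \<open>Eigenbases and their uniqueness\<close>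

text \<open>An injective walk on a path cannot turn back, so it keeps the direction of its first
  step; staying within \<open>{..d}\<close> then fixes where it starts.\<close>

lemma path_automorphism:
  fixes p :: "nat \<Rightarrow> nat"
  assumes p: "bij_betw p {..d} {..d}"
    and adj: "\<And>i. i < d \<Longrightarrow> p (Suc i) = Suc (p i) \<or> p i = Suc (p (Suc i))"
  shows "(\<forall>i\<le>d. p i = i) \<or> (\<forall>i\<le>d. p i = d - i)"
proof -
  have inj: "i \<le> d \<Longrightarrow> j \<le> d \<Longrightarrow> p i = p j \<Longrightarrow> i = j" for i j
    using p by (metis atMost_iff bij_betw_def inj_onD)
  have le: "i \<le> d \<Longrightarrow> p i \<le> d" for i
    using bij_betwE[OF p] by simp
  have "n \<le> d \<Longrightarrow> (\<forall>i\<le>n. p i = p 0 + i) \<or> (\<forall>i\<le>n. p i + i = p 0)" for n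
  proof (induction n)
    case (Suc n)
    show ?case
    proof (cases n)
      case 0
      then show ?thesis using adj[of 0] Suc.prems by (auto simp: le_Suc_eq)
    next
      case n: (Suc m)
      have neq: "p (Suc n) \<noteq> p m"
        using inj[of "Suc n" m] n \<open>Suc n \<le> d\<close> by linarith
      have adj_n: "p (Suc n) = Suc (p n) \<or> p n = Suc (p (Suc n))"
        using adj[of n] Suc.prems by simp
      have "(\<forall>i\<le>n. p i = p 0 + i) \<or> (\<forall>i\<le>n. p i + i = p 0)"
        by (rule Suc.IH[OF Suc_leD[OF Suc.prems]])
      then have "(\<forall>i\<le>n. p i = p 0 + i) \<and> p (Suc n) = p 0 + Suc n \<or>
          (\<forall>i\<le>n. p i + i = p 0) \<and> p (Suc n) + Suc n = p 0"
      proof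
        assume up: "\<forall>i\<le>n. p i = p 0 + i"
        then have "p n = p 0 + n" "p m = p 0 + m" using n by (metis le_refl, metis le_SucI le_refl)
        then have "p (Suc n) = p 0 + Suc n" using adj_n neq n by linarith
        then show ?thesis using up by blast
      next
        assume down: "\<forall>i\<le>n. p i + i = p 0"
        then have "p n + n = p 0" "p m + m = p 0" using n by (metis le_refl, metis le_SucI le_refl)
        then have "p (Suc n) + Suc n = p 0" using adj_n neq n by linarith
        then show ?thesis using down by blast
      qed
      then show ?thesis by (metis le_Suc_eq)
    qed
  qed simp
  then consider "\<forall>i\<le>d. p i = p 0 + i" | "\<forall>i\<le>d. p i + i = p 0" by blast
  then show ?thesis
  proof cases
    case 1
    then have "p d = p 0 + d" by blast
    moreover have "p d \<le> d" using le by simp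
    ultimately have "p 0 = 0" by simp
    then show ?thesis using 1 by (metis add_0)
  next
    case 2
    have "p 0 \<le> d" using le by simp
    then have "p 0 = d" using 2 by (metis le_add2 le_antisym le_refl)
    then show ?thesis using 2 by (metis add_diff_cancel_right')
  qed
qed

lemma bij_betw_reverse: "bij_betw (\<lambda>i. d - i) {..d} {..d :: nat}"
  by (rule bij_betwI[where g = "\<lambda>i. d - i"]) auto

context fin_space
begin

definition reversed :: "(nat \<Rightarrow> 'v) \<Rightarrow> nat \<Rightarrow> 'v" where
  "reversed v i = v (d - i)"

lemma basis_reversed: "basis v \<Longrightarrow> basis (reversed v)"
  by (rule basis_scale_permute[OF _ bij_betw_reverse, where c = "\<lambda>_. 1"]) (auto simp: reversed_def)

lemma mx_reversed: "basis v \<Longrightarrow> lin F \<Longrightarrow> i \<le> d \<Longrightarrow> j \<le> d \<Longrightarrow> mx (reversed v) F i j = mx v F (d - i) (d - j)"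
  using mx_scale_permute[OF _ bij_betw_reverse, where c = "\<lambda>_. 1" and u = "reversed v"] by (simp add: reversed_def)

lemma crd_reversed: "basis v \<Longrightarrow> x \<in> V \<Longrightarrow> i \<le> d \<Longrightarrow> crd (reversed v) i x = crd v (d - i) x"
  using crd_scale_permute[OF _ bij_betw_reverse, where c = "\<lambda>_. 1" and u = "reversed v"] by (simp add: reversed_def)

lemma diag_in_reversed: "diag_in v A \<theta> \<Longrightarrow> diag_in (reversed v) A (\<lambda>i. \<theta> (d - i))"
  by (simp add: diag_in_def reversed_def)

lemma irred_reversed: "basis v \<Longrightarrow> lin F \<Longrightarrow> irred v F \<Longrightarrow> irred (reversed v) F"
  unfolding irred_def
proof (intro conjI allI impI)
  fix i j assume *: "basis v" "lin F" "(\<forall>i\<le>d. \<forall>j\<le>d. mx v F i j \<noteq> 0 \<longrightarrow> i = j \<or> i = Suc j \<or> j = Suc i) \<and>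
     (\<forall>i<d. mx v F (Suc i) i \<noteq> 0 \<and> mx v F i (Suc i) \<noteq> 0)"
  show "i = j \<or> i = Suc j \<or> j = Suc i" if "i \<le> d" "j \<le> d" "mx (reversed v) F i j \<noteq> 0"
  proof -
    have "d - i = d - j \<or> d - i = Suc (d - j) \<or> d - j = Suc (d - i)"
      using * that by (simp add: mx_reversed)
    then show ?thesis using that by linarith
  qed
  assume "i < d"
  then have "d - i = Suc (d - Suc i)" "d - Suc i < d" by auto
  then show "mx (reversed v) F (Suc i) i \<noteq> 0" "mx (reversed v) F i (Suc i) \<noteq> 0"
    using * \<open>i < d\<close> by (simp_all add: mx_reversed)
qed

text \<open>Row i of the eigenvalue equation determines coordinate i + 1 from the earlier ones, as
  the superdiagonal entry there is nonzero. So coordinate 0 determines an eigenvector.\<close>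

lemma irred_eigenvector_first:
  assumes v: "basis v" and F: "lin F" and irr: "irred v F"
    and x: "x \<in> V" "F x = l *s x" and zero: "crd v 0 x = 0"
  shows "x = 0"
proof (rule crd_eqI[OF v])
  have step: "mx v F i (Suc i) * crd v (Suc i) x = 0"
    if i: "i < d" and z: "\<And>j. j \<le> i \<Longrightarrow> crd v j x = 0" for i
  proof -
    have "l * crd v i x = (\<Sum>j\<le>d. mx v F i j * crd v j x)"
      using crd_apply[OF F v x(1), of i] v x by simp
    also have "\<dots> = mx v F i (Suc i) * crd v (Suc i) x"
      using sum_tridiag_row[OF irr, of i "\<lambda>j. crd v j x"] i z by simp
    finally show ?thesis using z by simp
  qed
  show "crd v i x = crd v i 0" if "i \<le> d" for i
    using that
  proof (induction i rule: less_induct)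
    case (less i)
    show ?case
    proof (cases i)
      case (Suc k)
      then have "mx v F k (Suc k) * crd v (Suc k) x = 0"
        using less by (intro step) auto
      then show ?thesis using irr Suc less.prems by (auto simp: irred_def)
    qed (simp add: zero)
  qed
qed (use x in auto)

lemma irred_eigenvector_last:
  assumes v: "basis v" and F: "lin F" and irr: "irred v F"
    and x: "x \<in> V" "F x = l *s x" and zero: "crd v d x = 0"
  shows "x = 0"
  by (rule irred_eigenvector_first[OF basis_reversed[OF v] F irred_reversed[OF v F irr] x])
    (use v x zero in \<open>simp add: crd_reversed\<close>)

lemma basis_nonzero: "basis v \<Longrightarrow> i \<le> d \<Longrightarrow> v i \<noteq> 0"
  by (metis crd_basis crd_zero zero_neq_one)

text \<open>Two eigenvectors with the same eigenvalue have a combination whose coordinate 0 in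
  \<open>w\<close> is zero; by \<open>irred_eigenvector_first\<close> this combination vanishes,
  against independence.\<close>

lemma multiplicity_free:
  assumes v: "basis v" "diag_in v A \<theta>" and w: "basis w" "irred w A" and A: "lin A"
  shows "inj_on \<theta> {..d}"
proof (rule inj_onI, rule ccontr)
  fix i j assume ij: "i \<in> {..d}" "j \<in> {..d}" "\<theta> i = \<theta> j" "i \<noteq> j"
  define x where "x = crd w 0 (v j) *s v i - crd w 0 (v i) *s v j"
  have "A x = \<theta> i *s x"
    using ij v A by (simp add: x_def lin_diff lin_scale diag_in_def scale_right_diff_distrib mult.commute)
  then have "x = 0"
    using ij v w A by (intro irred_eigenvector_first[OF w(1) A w(2)]) (auto simp: x_def mult.commute)
  then have "crd v i x = 0" by simp
  then have "crd w 0 (v j) = 0" using ij v by (simp add: x_def)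
  then have "v j = 0"
    using ij v w A by (intro irred_eigenvector_first[OF w(1) A w(2), of "v j" "\<theta> j"]) (auto simp: diag_in_def)
  then show False using basis_nonzero v ij by auto
qed

lemma eigenvector_unique:
  assumes A: "lin A" and v: "basis v" "diag_in v A \<theta>" and inj: "inj_on \<theta> {..d}"
    and x: "x \<in> V" "A x = l *s x" "x \<noteq> 0"
  obtains j where "j \<le> d" "l = \<theta> j" "x = crd v j x *s v j" "crd v j x \<noteq> 0"
proof -
  have e: "\<theta> i * crd v i x = l * crd v i x" if "i \<le> d" for i
    using crd_diag[OF A v x(1) that] crd_scale[OF v(1) x(1)] x(2) by metis
  have "\<exists>j\<le>d. crd v j x \<noteq> 0"
    using crd_eqI[OF v(1) x(1) V_zero] x(3) by auto
  then obtain j where j: "j \<le> d" "crd v j x \<noteq> 0" by blast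
  then have l: "l = \<theta> j" using e by auto
  have "x = crd v j x *s v j"
  proof (rule crd_eqI[OF v(1)])
    show "crd v i x = crd v i (crd v j x *s v j)" if "i \<le> d" for i
    proof (cases "i = j")
      case False
      then have "\<theta> i \<noteq> l" using that j l inj by (auto dest: inj_onD)
      then show ?thesis using e[OF that] False that j v by simp
    qed (use v j in simp)
  qed (use x v j in auto)
  then show ?thesis using that j l by blast
qed

lemma eigenbasis_unique:
  assumes A: "lin A" and v: "basis v" "diag_in v A \<theta>" and inj: "inj_on \<theta> {..d}"
    and u: "basis u" "diag_in u A \<eta>"
  obtains p c where "bij_betw p {..d} {..d}" "\<And>i. i \<le> d \<Longrightarrow> c i \<noteq> 0" "\<And>i. i \<le> d \<Longrightarrow> u i = c i *s v (p i)"
proof -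
  have "\<exists>j a. j \<le> d \<and> a \<noteq> 0 \<and> u i = a *s v j" if "i \<le> d" for i
  proof -
    have "A (u i) = \<eta> i *s u i" using u that by (simp add: diag_in_def)
    then show ?thesis
      using eigenvector_unique[OF A v inj basis_in[OF u(1) that] _ basis_nonzero[OF u(1) that]] by metis
  qed
  then obtain p c where pc: "\<And>i. i \<le> d \<Longrightarrow> p i \<le> d \<and> c i \<noteq> 0 \<and> u i = c i *s v (p i)"
    by metis
  have "inj_on p {..d}"
  proof (rule inj_onI, rule ccontr)
    fix i j assume ij: "i \<in> {..d}" "j \<in> {..d}" "p i = p j" "i \<noteq> j"
    then have "c j *s u i = c i *s u j" using pc by (simp add: mult.commute)
    then have "crd u i (c j *s u i) = crd u i (c i *s u j)" by simp
    then have "c j = 0" using ij u(1) by simp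
    then show False using ij pc[of j] by simp
  qed
  moreover have "p ` {..d} \<subseteq> {..d}" using pc by auto
  ultimately have "bij_betw p {..d} {..d}"
    by (simp add: bij_betw_def endo_inj_surj)
  then show ?thesis using that pc by blast
qed

text \<open>Two eigenbases of \<open>A\<close> differ by a permutation and scalars. In both of them
  \<open>B\<close> links neighbouring indices and no others, so the permutation is an automorphism
  of the path.\<close>

lemma leonard_basis_unique:
  assumes A: "lin A" and B: "lin B" and v: "basis v" "diag_in v A \<theta>" "irred v B"
    and inj: "inj_on \<theta> {..d}" and u: "basis u" "diag_in u A \<eta>" "irred u B"
  obtains c where "\<And>i. i \<le> d \<Longrightarrow> c i \<noteq> 0"
    "(\<forall>i\<le>d. u i = c i *s v i) \<or> (\<forall>i\<le>d. u i = c i *s reversed v i)"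
proof -
  obtain p c where p: "bij_betw p {..d} {..d}" and c: "\<And>i. i \<le> d \<Longrightarrow> c i \<noteq> 0"
    and u_eq: "\<And>i. i \<le> d \<Longrightarrow> u i = c i *s v (p i)"
    using eigenbasis_unique[OF A v(1,2) inj u(1,2)] by blast
  have "p (Suc i) = Suc (p i) \<or> p i = Suc (p (Suc i))" if i: "i < d" for i
  proof -
    have "mx u B (Suc i) i \<noteq> 0" using u i by (simp add: irred_def)
    then have "mx v B (p (Suc i)) (p i) \<noteq> 0"
      using mx_scale_permute[OF v(1) p c u_eq B, of "Suc i" i] i by auto
    moreover have "p (Suc i) \<noteq> p i" "p (Suc i) \<le> d" "p i \<le> d"
      using p i by (auto simp: bij_betw_def inj_on_eq_iff)
    ultimately show ?thesis using v(3) by (metis irred_far)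
  qed
  then have "(\<forall>i\<le>d. p i = i) \<or> (\<forall>i\<le>d. p i = d - i)"
    by (rule path_automorphism[OF p])
  then show ?thesis using that[of c] c u_eq by (auto simp: reversed_def)
qed

end

section \<open>Leonard pairs with alternating eigenvalue gaps\<close>

text \<open>The value -1 of the Bannai/Ito quotient, with the denominator cleared and the index
  shifted by 2: sums of neighbouring eigenvalues have period two.\<close>

definition alternating_gaps :: "nat \<Rightarrow> (nat \<Rightarrow> 'k::field) \<Rightarrow> bool" where
  "alternating_gaps d \<theta> \<longleftrightarrow> (\<forall>i. i + 3 \<le> d \<longrightarrow> \<theta> i + \<theta> (i + 1) = \<theta> (i + 2) + \<theta> (i + 3))"

lemma alternating_gaps_sum:
  assumes "alternating_gaps d \<theta>" "i < d"
  shows "\<theta> i + \<theta> (Suc i) = (if even i then \<theta> 0 + \<theta> 1 else \<theta> 1 + \<theta> 2)"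
  using assms(2)
proof (induction i rule: less_induct)
  case (less i)
  consider "i = 0" | "i = 1" | j where "i = Suc (Suc j)" by (metis One_nat_def not0_implies_Suc)
  then show ?case
  proof cases
    case 3
    have "j + 3 \<le> d" using 3 less.prems by simp
    then have "\<theta> j + \<theta> (j + 1) = \<theta> (j + 2) + \<theta> (j + 3)"
      using assms(1) unfolding alternating_gaps_def by blast
    moreover have "j + 1 = Suc j" "j + 2 = i" "j + 3 = Suc i" using 3 by auto
    moreover have "\<theta> j + \<theta> (Suc j) = (if even j then \<theta> 0 + \<theta> 1 else \<theta> 1 + \<theta> 2)"
      using less 3 by auto
    moreover have "even i = even j" using 3 by simp
    ultimately show ?thesis by metis
  qed (auto simp: numeral_2_eq_2)
qed

lemma alternating_gaps_reverse:
  "alternating_gaps d \<theta> \<Longrightarrow> alternating_gaps d (\<lambda>i. \<theta> (d - i))"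
  unfolding alternating_gaps_def
proof (intro allI impI)
  fix i assume *: "\<forall>i. i + 3 \<le> d \<longrightarrow> \<theta> i + \<theta> (i + 1) = \<theta> (i + 2) + \<theta> (i + 3)" "i + 3 \<le> d"
  define j where "j = d - (i + 3)"
  have "d - i = j + 3" "d - (i + 1) = j + 2" "d - (i + 2) = j + 1" "d - (i + 3) = j"
    using *(2) by (auto simp: j_def)
  moreover have "j + 3 \<le> d" using *(2) by (simp add: j_def)
  ultimately show "\<theta> (d - i) + \<theta> (d - (i + 1)) = \<theta> (d - (i + 2)) + \<theta> (d - (i + 3))"
    using *(1) by (simp add: add.commute)
qed

locale fin_space_0 = fin_space s V d
  for s :: "'k::field_char_0 \<Rightarrow> 'v::ab_group_add \<Rightarrow> 'v" (infixr \<open>*s\<close> 75)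
    and V :: "'v set" and d :: nat
begin

definition anchored :: "(nat \<Rightarrow> 'v) \<Rightarrow> ('v \<Rightarrow> 'v) \<Rightarrow> bool" where
  "anchored v B \<longleftrightarrow> irred v B \<and> mx v B 0 0 \<noteq> 0 \<and> (\<forall>i\<le>d. 0 < i \<longrightarrow> mx v B i i = 0)"

definition bracket :: "'k \<Rightarrow> 'k \<Rightarrow> ('v \<Rightarrow> 'v) \<Rightarrow> ('v \<Rightarrow> 'v) \<Rightarrow> 'v \<Rightarrow> 'v" where
  "bracket g r A B x = A (A (B x)) + A (B (A x)) + A (B (A x)) + B (A (A x))
     - g *s (A (B x) + B (A x)) - r *s B x"

lemma lin_bracket: "lin A \<Longrightarrow> lin B \<Longrightarrow> lin (bracket g r A B)"
  unfolding linear_map_on_def bracket_def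
  by (auto simp: scale_right_distrib scale_right_diff_distrib algebra_simps)

lemma crd_bracket_diag:
  assumes A: "lin A" and B: "lin B" and v: "basis v" "diag_in v A \<theta>" and ij: "i \<le> d" "j \<le> d"
  shows "mx v (bracket g r A B) i j = ((\<theta> i + \<theta> j)\<^sup>2 - g * (\<theta> i + \<theta> j) - r) * mx v B i j"
proof -
  have "A (v j) = \<theta> j *s v j" using v ij by (simp add: diag_in_def)
  then show ?thesis
    using A B v ij
    by (simp add: mx_def bracket_def lin_scale crd_diag[OF A v] power2_eq_square algebra_simps)
qed

text \<open>Here \<open>B\<close> is the diagonal map. The words A^2 B + 2 A B A + B A^2 give the
  walk from j over k to i the weight \<open>\<eta> i + 2 * \<eta> k + \<eta> j\<close>.\<close>

lemma crd_bracket_tridiag: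
  assumes A: "lin A" and B: "lin B" and w: "basis w" "diag_in w B \<eta>" and ij: "i \<le> d" "j \<le> d"
  shows "mx w (bracket g r A B) i j =
    (\<Sum>k\<le>d. mx w A i k * ((\<eta> i + 2 * \<eta> k + \<eta> j) * mx w A k j)) - g * (\<eta> i + \<eta> j) * mx w A i j
      - r * mx w B i j"
proof -
  have wj: "B (w j) = \<eta> j *s w j" using w ij by (simp add: diag_in_def)
  have AA: "crd w i (A (A (w j))) = (\<Sum>k\<le>d. mx w A i k * mx w A k j)"
    using crd_apply[OF A w(1), of "A (w j)" i] A w ij by (simp add: mx_def)
  have ABA: "crd w i (A (B (A (w j)))) = (\<Sum>k\<le>d. mx w A i k * (\<eta> k * mx w A k j))"
    using crd_apply[OF A w(1), of "B (A (w j))" i] A B w ij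
    by (simp add: mx_def crd_diag[OF B w])
  have "mx w (bracket g r A B) i j = \<eta> j * crd w i (A (A (w j))) + 2 * crd w i (A (B (A (w j))))
      + \<eta> i * crd w i (A (A (w j))) - g * (\<eta> i + \<eta> j) * mx w A i j - r * mx w B i j"
    using A B w ij wj by (simp add: mx_def bracket_def lin_scale crd_diag[OF B w] algebra_simps)
  also have "\<eta> j * crd w i (A (A (w j))) + 2 * crd w i (A (B (A (w j)))) + \<eta> i * crd w i (A (A (w j)))
    = (\<Sum>k\<le>d. mx w A i k * ((\<eta> i + 2 * \<eta> k + \<eta> j) * mx w A k j))"
    unfolding AA ABA sum_distrib_left sum.distrib[symmetric]
    by (rule sum.cong) (auto simp: algebra_simps)
  finally show ?thesis .
qed

text \<open>The bracket kills all of \<open>v\<close> but \<open>v 0\<close>, so it has rank at most one. As \<open>d \<ge> 3\<close>, the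
  corner \<open>(d, 0)\<close> of its pentadiagonal matrix in the basis \<open>w\<close> vanishes, while eigenvectors of
  irreducible tridiagonal matrices have nonzero end coordinates: the bracket is zero.\<close>

lemma bracket_vanishes:
  assumes d: "d \<ge> 3" and A: "lin A" and B: "lin B"
    and v: "basis v" "diag_in v A \<theta>" "anchored v B" "alternating_gaps d \<theta>"
    and w: "basis w" "diag_in w B \<eta>" "anchored w A" "alternating_gaps d \<eta>"
  shows "\<theta> 1 + \<theta> 2 = 2 * \<theta> 0"
    and "\<And>x. x \<in> V \<Longrightarrow> bracket (\<theta> 0 + 2 * \<theta> 1 + \<theta> 2) (- (\<theta> 0 + \<theta> 1) * (\<theta> 1 + \<theta> 2)) A B x = 0"
    and "\<eta> 0 + 2 * \<eta> 1 + \<eta> 2 = 0"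
proof -
  define p q where "p = \<theta> 0 + \<theta> 1" and "q = \<theta> 1 + \<theta> 2"
  define X where "X = bracket (p + q) (- p * q) A B"
  have X: "lin X" unfolding X_def by (rule lin_bracket[OF A B])
  have irr: "irred v B" "irred w A" using v w by (auto simp: anchored_def)
  have ent: "mx v X i j = (\<theta> i + \<theta> j - p) * (\<theta> i + \<theta> j - q) * mx v B i j" if "i \<le> d" "j \<le> d" for i j
    unfolding X_def crd_bracket_diag[OF A B v(1,2) that] by (simp add: power2_eq_square algebra_simps)
  have ent0: "mx v X i j = 0" if ij: "i \<le> d" "j \<le> d" "i \<noteq> 0 \<or> j \<noteq> 0" for i j
  proof -
    consider "i = j" | "i = Suc j" | "j = Suc i" | "mx v B i j = 0"
      using irr(1) ij by (metis irred_far)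
    then show ?thesis
    proof cases
      case 1
      then show ?thesis using v(3) ij ent by (simp add: anchored_def)
    next
      case 2
      then have "\<theta> i + \<theta> j = p \<or> \<theta> i + \<theta> j = q"
        using alternating_gaps_sum[OF v(4), of j] ij by (auto simp: p_def q_def add.commute)
      then show ?thesis using ent ij by auto
    next
      case 3
      then have "\<theta> i + \<theta> j = p \<or> \<theta> i + \<theta> j = q"
        using alternating_gaps_sum[OF v(4), of i] ij by (auto simp: p_def q_def)
      then show ?thesis using ent ij by auto
    qed (use ent ij in simp)
  qed
  define c where "c = mx v X 0 0"
  have Xx: "X x = (c * crd v 0 x) *s v 0" if x: "x \<in> V" for x
  proof (rule crd_eqI[OF v(1)])
    fix i assume i: "i \<le> d"
    have "crd v i (X x) = (\<Sum>j\<le>d. mx v X i j * crd v j x)" by (rule crd_apply[OF X v(1) x])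
    also have "\<dots> = (\<Sum>j\<le>d. if j = 0 then mx v X i 0 * crd v 0 x else 0)"
      using i ent0 by (intro sum.cong) auto
    also have "\<dots> = crd v i ((c * crd v 0 x) *s v 0)"
      using i v ent0[of i 0] by (auto simp: c_def)
    finally show "crd v i (X x) = crd v i ((c * crd v 0 x) *s v 0)" .
  qed (use X x v in auto)
  have mxw: "mx w X i 0 = (\<Sum>k\<le>d. mx w A i k * ((\<eta> i + 2 * \<eta> k + \<eta> 0) * mx w A k 0))"
    if "2 \<le> i" "i \<le> d" for i
    unfolding X_def
    using crd_bracket_tridiag[OF A B w(1,2), of i 0] that irred_far[OF irr(2), of i 0] diag_in_mx[OF w(1,2), of i 0]
    by simp
  have "mx w X d 0 = 0"
    using mxw[of d] sum_tridiag_row[OF irr(2), of d "\<lambda>k. (\<eta> d + 2 * \<eta> k + \<eta> 0) * mx w A k 0"]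
      irred_far[OF irr(2), of d 0] irred_far[OF irr(2), of "d - 1" 0] d by simp
  then have "c * crd v 0 (w 0) * crd w d (v 0) = 0"
    using Xx[of "w 0"] v w by (simp add: mx_def)
  moreover have "crd v 0 (w 0) \<noteq> 0"
    using irred_eigenvector_first[OF v(1) B irr(1), of "w 0" "\<eta> 0"] w basis_nonzero[OF w(1), of 0]
    by (auto simp: diag_in_def)
  moreover have "crd w d (v 0) \<noteq> 0"
    using irred_eigenvector_last[OF w(1) A irr(2), of "v 0" "\<theta> 0"] v basis_nonzero[OF v(1), of 0]
    by (auto simp: diag_in_def)
  ultimately have c: "c = 0" by simp
  have inj: "inj_on \<theta> {..d}" by (rule multiplicity_free[OF v(1,2) w(1) irr(2) A])
  then have "\<theta> 0 \<noteq> \<theta> 1" using d by (auto dest: inj_onD)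
  \<comment> \<open>The first factor is \<open>\<theta> 0 - \<theta> 1\<close>, which is nonzero
    since \<open>A\<close> has no repeated eigenvalue; so the second one vanishes.\<close>
  moreover have "(\<theta> 0 + \<theta> 0 - p) * (\<theta> 0 + \<theta> 0 - q) = 0"
    using c ent[of 0 0] v(3) by (simp add: c_def anchored_def)
  ultimately show "\<theta> 1 + \<theta> 2 = 2 * \<theta> 0" by (simp add: p_def q_def)
  have X0: "X x = 0" if "x \<in> V" for x using Xx[OF that] c by simp
  then show "bracket (\<theta> 0 + 2 * \<theta> 1 + \<theta> 2) (- (\<theta> 0 + \<theta> 1) * (\<theta> 1 + \<theta> 2)) A B x = 0" if "x \<in> V" for x
    using that by (simp add: X_def p_def q_def algebra_simps)
  \<comment> \<open>Only the walk 0, 1, 2 contributes to this entry, which isolates its weight as a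
    linear condition on \<open>\<eta>\<close>.\<close>
  have "mx w X 2 0 = 0" using X0[of "w 0"] w by (simp add: mx_def)
  then have "mx w A 2 1 * ((\<eta> 2 + 2 * \<eta> 1 + \<eta> 0) * mx w A 1 0) = 0"
    using mxw[of 2] sum_tridiag_row[OF irr(2), of 2 "\<lambda>k. (\<eta> 2 + 2 * \<eta> k + \<eta> 0) * mx w A k 0"]
      irred_far[OF irr(2), of 2 0] irred_far[OF irr(2), of 3 0] d by simp
  moreover have "mx w A 2 1 \<noteq> 0" "mx w A 1 0 \<noteq> 0"
    using irr(2) d unfolding irred_def by (auto simp: numeral_2_eq_2)
  ultimately have "\<eta> 2 + 2 * \<eta> 1 + \<eta> 0 = 0" by (metis mult_eq_0_iff)
  then show "\<eta> 0 + 2 * \<eta> 1 + \<eta> 2 = 0" by (simp add: algebra_simps)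
qed

text \<open>\<open>bracket_vanishes\<close> is applied to both orders of the pair. This yields
  \<open>\<theta> 1 + \<theta> 2 = 2 * \<theta> 0\<close> and
  \<open>\<theta> 0 + 2 * \<theta> 1 + \<theta> 2 = 0\<close>, hence
  \<open>\<theta> 1 = - 3 * \<theta> 0\<close> and \<open>\<theta> 2 = 5 * \<theta> 0\<close>. The
  neighbour sums are then -2 and 2 times \<open>\<theta> 0\<close>, which explains the coefficients
  0 and \<open>4 * (\<theta> 0)\<^sup>2\<close> of the bracket.\<close>

lemma anchored_pair:
  assumes d: "d \<ge> 3" and A: "lin A" and B: "lin B"
    and v: "basis v" "diag_in v A \<theta>" "anchored v B" "alternating_gaps d \<theta>"
    and w: "basis w" "diag_in w B \<eta>" "anchored w A" "alternating_gaps d \<eta>"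
  shows "\<And>i. i \<le> d \<Longrightarrow> \<theta> i = (-1) ^ i * (2 * of_nat i + 1) * \<theta> 0"
    and "\<And>x. x \<in> V \<Longrightarrow> bracket 0 (4 * (\<theta> 0)\<^sup>2) A B x = 0"
    and "\<theta> 0 \<noteq> 0"
proof -
  note 1 = bracket_vanishes[OF d A B v w] and 2 = bracket_vanishes[OF d B A w v]
  have gam: "\<theta> 0 + 2 * \<theta> 1 + \<theta> 2 = 0" by (rule 2(3))
  have "3 * \<theta> 0 + \<theta> 1 = (\<theta> 0 + 2 * \<theta> 1 + \<theta> 2) - (\<theta> 1 + \<theta> 2 - 2 * \<theta> 0)" by simp
  then have "3 * \<theta> 0 + \<theta> 1 = 0" unfolding gam 1(1) by simp
  then have t1: "\<theta> 1 = - 3 * \<theta> 0" by (simp add: add_eq_0_iff)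
  have "\<theta> 2 = 2 * \<theta> 0 - \<theta> 1" unfolding 1(1)[symmetric] by simp
  then have t2: "\<theta> 2 = 5 * \<theta> 0" unfolding t1 by simp
  show th: "\<theta> i = (-1) ^ i * (2 * of_nat i + 1) * \<theta> 0" if "i \<le> d" for i
    using that
  proof (induction i)
    case (Suc i)
    have "\<theta> (Suc i) = (if even i then \<theta> 0 + \<theta> 1 else \<theta> 1 + \<theta> 2) - \<theta> i"
      using alternating_gaps_sum[OF v(4), of i] Suc.prems by (simp add: algebra_simps)
    also have "\<dots> = (- 1) ^ Suc i * (2 * of_nat (Suc i) + 1) * \<theta> 0"
      unfolding t1 t2 using Suc by (cases "even i") (simp_all add: algebra_simps)
    finally show ?case .
  qed simp
  show "bracket 0 (4 * (\<theta> 0)\<^sup>2) A B x = 0" if "x \<in> V" for x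
  proof -
    have "- (\<theta> 0 + \<theta> 1) * (\<theta> 1 + \<theta> 2) = 4 * (\<theta> 0)\<^sup>2"
      unfolding t1 t2 by (simp add: power2_eq_square)
    then show ?thesis using 1(2)[OF that] unfolding gam by argo
  qed
  have inj: "inj_on \<theta> {..d}"
    using multiplicity_free[OF v(1,2) w(1) _ A] w(3) by (simp add: anchored_def)
  have "\<theta> 0 \<noteq> \<theta> 1" using inj_onD[OF inj, of 0 1] d by auto
  then show "\<theta> 0 \<noteq> 0" using t1 by auto
qed

section \<open>From the cubic relations to the matrix entries\<close>

text \<open>Up to the factor \<open>2 * c\<close> these eigenvalues are the half-odd numbers i + 1/2
  with alternating signs; \<open>c\<close> is the eigenvalue at index 0.\<close>

definition half_odd :: "(nat \<Rightarrow> 'v) \<Rightarrow> ('v \<Rightarrow> 'v) \<Rightarrow> 'k \<Rightarrow> bool" where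
  "half_odd v A c \<longleftrightarrow> diag_in v A (\<lambda>i. (-1) ^ i * (2 * of_nat i + 1) * c)"

lemma anchored_irred: "anchored v B \<Longrightarrow> irred v B"
  by (simp add: anchored_def)

lemma trace_anchored: "basis v \<Longrightarrow> lin B \<Longrightarrow> anchored v B \<Longrightarrow> trace_on s V B = mx v B 0 0"
proof -
  assume v: "basis v" "lin B" "anchored v B"
  have "(\<Sum>i\<le>d. mx v B i i) = (\<Sum>i\<in>{0}. mx v B i i)"
    using v(3) by (intro sum.mono_neutral_right) (auto simp: anchored_def)
  then show ?thesis by (simp add: trace_eq[OF v(1,2)])
qed

lemma sum_alternating_odd: "(\<Sum>i\<le>n. (-1) ^ i * (2 * of_nat i + 1)) = (-1) ^ n * (of_nat n + 1 :: 'k)"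
  by (induction n) (simp_all add: algebra_simps)

lemma trace_half_odd:
  assumes "basis v" "lin A" "half_odd v A c"
  shows "trace_on s V A = (-1) ^ d * (of_nat d + 1) * c"
proof -
  have "trace_on s V A = (\<Sum>i\<le>d. (-1) ^ i * (2 * of_nat i + 1) * c)"
    using assms diag_in_mx[OF assms(1)] unfolding half_odd_def
    by (subst trace_eq[OF assms(1,2)]) (auto intro!: sum.cong)
  then show ?thesis by (simp add: sum_distrib_right[symmetric] sum_alternating_odd)
qed

text \<open>The relation is the diagonal part of \<open>B\<^sup>2A + 2BAB + AB\<^sup>2 = r A\<close>; it is solved downwards
  from \<open>i = d\<close>.\<close>

lemma offdiag_products:
  assumes A: "lin A" and B: "lin B" and v: "basis v" "half_odd v A c" "anchored v B"
    and c: "c \<noteq> 0" and d: "d \<ge> 1" and rel: "\<forall>x\<in>V. bracket 0 r B A x = 0"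
  shows "r * (of_nat d + 1)\<^sup>2 = 4 * (mx v B 0 0)\<^sup>2"
    and "\<And>i. i < d \<Longrightarrow> 4 * (mx v B (Suc i) i * mx v B i (Suc i)) = r * ((of_nat d + 1)\<^sup>2 - (of_nat i + 1)\<^sup>2)"
proof -
  define \<theta> where "\<theta> i = (-1) ^ i * (2 * of_nat i + 1) * c" for i
  have vA: "diag_in v A \<theta>" using v(2) by (simp add: half_odd_def \<theta>_def[abs_def])
  note irr = anchored_irred[OF v(3)]
  \<comment> \<open>The value 0 at \<open>d\<close> stands for the product beyond the last index, so
    that the recursion \<open>ei\<close> also covers the last row and the downward induction can
    start there.\<close>
  define y where "y i = (if i < d then mx v B (Suc i) i * mx v B i (Suc i) else 0)" for i
  have eq: "(\<Sum>k\<le>d. mx v B i k * ((2 * (\<theta> i + \<theta> k)) * mx v B k i)) = r * \<theta> i" if i: "i \<le> d" for i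
  proof -
    have "mx v (bracket 0 r B A) i i = 0" using rel v i by (simp add: mx_def)
    then show ?thesis
      using crd_bracket_tridiag[OF B A v(1) vA, of i i 0 r] i diag_in_mx[OF v(1) vA, of i i]
      by (simp add: algebra_simps)
  qed
  have th: "\<theta> i + \<theta> (Suc i) = - 2 * (-1) ^ i * c" for i
    by (simp add: \<theta>_def algebra_simps)
  \<comment> \<open>Row 0 is the only one that meets the diagonal entry of \<open>B\<close>; it ties
    this entry to the first product.\<close>
  have "mx v B 0 0 * (2 * (\<theta> 0 + \<theta> 0) * mx v B 0 0) +
      mx v B 0 (Suc 0) * (2 * (\<theta> 0 + \<theta> (Suc 0)) * mx v B (Suc 0) 0) = r * \<theta> 0"
    using eq[of 0] sum_tridiag_row[OF irr, of 0 "\<lambda>k. 2 * (\<theta> 0 + \<theta> k) * mx v B k 0"] d by simp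
  then have "(4 * (mx v B 0 0)\<^sup>2 - 4 * y 0) * c = r * c"
    unfolding th using d by (simp add: y_def \<theta>_def power2_eq_square algebra_simps)
  then have "4 * (mx v B 0 0)\<^sup>2 - 4 * y 0 = r" using c by (simp only: mult_cancel_right) simp
  then have e0: "4 * (mx v B 0 0)\<^sup>2 = r + 4 * y 0" by (simp add: algebra_simps)
  have ei: "4 * y i = r * (2 * of_nat (Suc i) + 1) + 4 * y (Suc i)" if i: "i < d" for i
  proof -
    have "mx v B (Suc i) i * (2 * (\<theta> i + \<theta> (Suc i)) * mx v B i (Suc i)) +
        (if Suc i = d then 0 else mx v B (Suc i) (Suc (Suc i)) *
          (2 * (\<theta> (Suc i) + \<theta> (Suc (Suc i))) * mx v B (Suc (Suc i)) (Suc i))) = r * \<theta> (Suc i)"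
      using eq[of "Suc i"] sum_tridiag_row[OF irr, of "Suc i" "\<lambda>k. 2 * (\<theta> (Suc i) + \<theta> k) * mx v B k (Suc i)"]
        i v(3) by (simp add: anchored_def add.commute)
    then have "(- 4 * y i + 4 * y (Suc i)) * ((-1) ^ i * c) = - r * (2 * of_nat (Suc i) + 1) * ((-1) ^ i * c)"
      unfolding th using i by (auto simp: y_def \<theta>_def algebra_simps)
    then have "- 4 * y i + 4 * y (Suc i) = - r * (2 * of_nat (Suc i) + 1)"
      using c by (simp only: mult_cancel_right) simp
    then show ?thesis by (simp add: algebra_simps)
  qed
  have y: "4 * y i = r * ((of_nat d + 1)\<^sup>2 - (of_nat i + 1)\<^sup>2)" if "i \<le> d" for i
    using that
  proof (induction i rule: inc_induct)
    case base
    show ?case by (simp add: y_def)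
  next
    case (step i)
    then show ?case using ei[of i] by (simp add: power2_eq_square algebra_simps)
  qed
  show "4 * (mx v B (Suc i) i * mx v B i (Suc i)) = r * ((of_nat d + 1)\<^sup>2 - (of_nat i + 1)\<^sup>2)"
    if "i < d" for i
    using y[of i] that by (simp add: y_def)
  show "r * (of_nat d + 1)\<^sup>2 = 4 * (mx v B 0 0)\<^sup>2"
    unfolding e0 using y[of 0] by (simp add: algebra_simps)
qed

lemma crd_row0:
  assumes "lin F" "basis v" "anchored v F" "d \<ge> 1" "x \<in> V"
  shows "crd v 0 (F x) = mx v F 0 0 * crd v 0 x + mx v F 0 1 * crd v 1 x"
  using crd_apply[OF assms(1,2,5), of 0] sum_tridiag_row[OF anchored_irred[OF assms(3)], of 0 "\<lambda>j. crd v j x"] assms(4)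
  by simp

lemma crd_row_Suc:
  assumes "lin F" "basis v" "anchored v F" "i < d" "x \<in> V"
  shows "crd v (Suc i) (F x) = mx v F (Suc i) i * crd v i x +
    (if Suc i = d then 0 else mx v F (Suc i) (Suc (Suc i)) * crd v (Suc (Suc i)) x)"
  using crd_apply[OF assms(1,2,5), of "Suc i"]
    sum_tridiag_row[OF anchored_irred[OF assms(3)], of "Suc i" "\<lambda>j. crd v j x"] assms(3,4)
  by (simp add: anchored_def)

lemma two_steps_far:
  assumes F: "lin F" "anchored v F" and G: "lin G" "anchored v G" and v: "basis v"
    and k: "i + 2 < k" "k \<le> d"
  shows "crd v k (F (G (v i))) = 0"
proof -
  obtain m where m: "k = Suc m" using k by (cases k) auto
  have far: "i + 1 < n \<Longrightarrow> n \<le> d \<Longrightarrow> crd v n (G (v i)) = 0" for n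
    using irred_far[OF anchored_irred[OF G(2)], of n i] by (simp add: mx_def)
  show ?thesis
    using crd_row_Suc[OF F(1) v F(2), of m "G (v i)"] far m k v G(1) by simp
qed

text \<open>Entries of a product are sums over walks, and only a walk that climbs at each of its
  three steps gets from i to i + 3.\<close>

lemma three_steps:
  assumes F: "lin F" "anchored v F" and G: "lin G" "anchored v G" and H: "lin H" "anchored v H"
    and v: "basis v" and i: "i + 3 \<le> d"
  shows "crd v (Suc (Suc (Suc i))) (F (G (H (v i)))) =
    mx v F (Suc (Suc (Suc i))) (Suc (Suc i)) * mx v G (Suc (Suc i)) (Suc i) * mx v H (Suc i) i"
proof -
  have far: "i + 1 < n \<Longrightarrow> n \<le> d \<Longrightarrow> crd v n (H (v i)) = 0" for n
    using irred_far[OF anchored_irred[OF H(2)], of n i] by (simp add: mx_def)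
  have "crd v (Suc (Suc i)) (G (H (v i))) = mx v G (Suc (Suc i)) (Suc i) * mx v H (Suc i) i"
    using crd_row_Suc[OF G(1) v G(2), of "Suc i" "H (v i)"] far v H(1) i by (simp add: mx_def)
  then show ?thesis
    using crd_row_Suc[OF F(1) v F(2), of "Suc (Suc i)" "G (H (v i))"] two_steps_far[OF G H v, of i] v G(1) H(1) i
    by simp
qed

text \<open>Without a loop, three steps from 0 to 2 have the wrong parity. The only loop is at 0, so
  it must be the first step.\<close>

lemma three_steps_2_0:
  assumes F: "lin F" "anchored v F" and G: "lin G" "anchored v G" and H: "lin H" "anchored v H"
    and v: "basis v" and d: "3 \<le> d"
  shows "crd v 2 (F (G (H (v 0)))) = mx v F 2 1 * mx v G 1 0 * mx v H 0 0"
proof -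
  have far: "1 < n \<Longrightarrow> n \<le> d \<Longrightarrow> crd v n (H (v 0)) = 0" for n
    using irred_far[OF anchored_irred[OF H(2)], of n 0] by (simp add: mx_def)
  have "crd v 1 (G (H (v 0))) = mx v G 1 0 * mx v H 0 0"
    using crd_row_Suc[OF G(1) v G(2), of 0 "H (v 0)"] far[of 2] v H(1) d by (simp add: mx_def numeral_2_eq_2)
  then show ?thesis
    using crd_row_Suc[OF F(1) v F(2), of 1 "G (H (v 0))"] two_steps_far[OF G H v, of 0 3] v G(1) H(1) d
    by (simp add: numeral_2_eq_2 numeral_3_eq_3)
qed

text \<open>A closed walk of length three at 0 runs through the loop three times, or once before or
  after the excursion to 1.\<close>

lemma three_steps_0_0:
  assumes F: "lin F" "anchored v F" and G: "lin G" "anchored v G" and H: "lin H" "anchored v H"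
    and v: "basis v" and d: "3 \<le> d"
  shows "crd v 0 (F (G (H (v 0)))) =
    mx v F 0 0 * (mx v G 0 0 * mx v H 0 0 + mx v G 0 1 * mx v H 1 0) + mx v F 0 1 * (mx v G 1 0 * mx v H 0 0)"
proof -
  have far: "1 < n \<Longrightarrow> n \<le> d \<Longrightarrow> crd v n (H (v 0)) = 0" for n
    using irred_far[OF anchored_irred[OF H(2)], of n 0] by (simp add: mx_def)
  have "crd v 1 (G (H (v 0))) = mx v G 1 0 * mx v H 0 0"
    using crd_row_Suc[OF G(1) v G(2), of 0 "H (v 0)"] far[of 2] v H(1) d by (simp add: mx_def numeral_2_eq_2)
  moreover have "crd v 0 (G (H (v 0))) = mx v G 0 0 * mx v H 0 0 + mx v G 0 1 * mx v H 1 0"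
    using crd_row0[OF G(1) v G(2), of "H (v 0)"] v H(1) d by (simp add: mx_def)
  ultimately show ?thesis
    using crd_row0[OF F(1) v F(2), of "G (H (v 0))"] v G(1) H(1) d by simp
qed

lemma mx_bracket_0:
  assumes "lin B" "lin E" "basis v" "i \<le> d" "j \<le> d"
  shows "mx v (bracket 0 r B E) i j = crd v i (B (B (E (v j)))) + 2 * crd v i (B (E (B (v j))))
    + crd v i (E (B (B (v j)))) - r * mx v E i j"
  using assms by (simp add: bracket_def mx_def)

text \<open>The subdiagonal of \<open>E\<close> is tied to that of \<open>B\<close> by the entries \<open>(0,0)\<close>, \<open>(2,0)\<close> and \<open>(i+3,i)\<close>
  of \<open>B\<^sup>2E + 2BEB + EB\<^sup>2 = r E\<close>; the first of them is a square.\<close>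

lemma third_offdiag:
  assumes B: "lin B" "anchored v B" and E: "lin E" "anchored v E" and v: "basis v" and d: "d \<ge> 3"
    and prod: "\<forall>i<d. (mx v B 0 0)\<^sup>2 * (mx v E (Suc i) i * mx v E i (Suc i)) =
       (mx v E 0 0)\<^sup>2 * (mx v B (Suc i) i * mx v B i (Suc i))"
    and r: "r + 4 * (mx v B 1 0 * mx v B 0 1) = 4 * (mx v B 0 0)\<^sup>2"
    and rel: "\<forall>x\<in>V. bracket 0 r B E x = 0"
    and i: "i < d"
  shows "mx v B 0 0 * mx v E (Suc i) i = - ((-1) ^ i) * mx v E 0 0 * mx v B (Suc i) i"
    and "mx v B 0 0 * mx v E i (Suc i) = - ((-1) ^ i) * mx v E 0 0 * mx v B i (Suc i)"
proof -
  define a e where "a = mx v B 0 0" and "e = mx v E 0 0"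
  have a: "a \<noteq> 0" and e: "e \<noteq> 0" using B E by (auto simp: a_def e_def anchored_def)
  have nz: "mx v B (Suc i) i \<noteq> 0" "mx v B i (Suc i) \<noteq> 0" "mx v E (Suc i) i \<noteq> 0" if "i < d" for i
    using B E that by (auto simp: anchored_def irred_def)
  have mx0: "mx v (bracket 0 r B E) i j = 0" if "i \<le> d" "j \<le> d" for i j
    using rel v that by (simp add: mx_def)
  note ent = mx_bracket_0[OF B(1) E(1) v, of _ _ r]
  have i0: "a * mx v E 1 0 = - e * mx v B 1 0"
  proof -
    let ?b = "mx v B 1 0" and ?b' = "mx v B 0 1" and ?e = "mx v E 1 0" and ?e' = "mx v E 0 1"
    have "(a * (a * e + ?b' * ?e) + ?b' * (?b * e)) + 2 * (a * (e * a + ?e' * ?b) + ?b' * (?e * a))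
        + (e * (a * a + ?b' * ?b) + ?e' * (?b * a)) - r * e = 0"
      using mx0[of 0 0] ent[of 0 0] three_steps_0_0[OF B B E v d] three_steps_0_0[OF B E B v d]
        three_steps_0_0[OF E B B v d] by (simp add: a_def e_def)
    moreover have "r = 4 * a\<^sup>2 - 4 * (?b * ?b')" using r by (simp add: a_def algebra_simps)
    ultimately have "3 * (a * (?b' * ?e + ?e' * ?b) + 2 * (?b * ?b' * e)) = 0"
      by (simp add: power2_eq_square algebra_simps)
    then have "a * (?b' * ?e + ?e' * ?b) + 2 * (?b * ?b' * e) = 0"
      by (metis mult_eq_0_iff zero_neq_numeral)
    moreover have "a\<^sup>2 * (?e * ?e') = e\<^sup>2 * (?b * ?b')"
      using prod d by (simp add: a_def e_def)
    \<comment> \<open>The numbers \<open>a * ?b' * ?e\<close> and \<open>a * ?e' * ?b\<close> have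
      the sum \<open>- 2 * (?b * ?b' * e)\<close> and, by \<open>prod\<close>, the product
      \<open>(?b * ?b' * e)\<^sup>2\<close>. So they are equal; the identity below is this
      discriminant argument.\<close>
    moreover have "?b' * (a * ?e + e * ?b)\<^sup>2 = a * ?e * (a * (?b' * ?e + ?e' * ?b) + 2 * (?b * ?b' * e))
        - ?b * (a\<^sup>2 * (?e * ?e') - e\<^sup>2 * (?b * ?b'))"
      by (simp add: power2_eq_square algebra_simps)
    ultimately have "?b' * (a * ?e + e * ?b)\<^sup>2 = 0" by simp
    then show ?thesis using nz[of 0] d by (simp add: eq_neg_iff_add_eq_0)
  qed
  have i1: "a * mx v E 2 1 = e * mx v B 2 1"
  proof -
    have "mx v B 2 1 * mx v B 1 0 * e + 2 * (mx v B 2 1 * mx v E 1 0 * a) + mx v E 2 1 * mx v B 1 0 * a = 0"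
      using mx0[of 2 0] ent[of 2 0] three_steps_2_0[OF B B E v d] three_steps_2_0[OF B E B v d]
        three_steps_2_0[OF E B B v d] d irred_far[OF anchored_irred[OF E(2)], of 2 0] by (simp add: a_def e_def)
    moreover have "mx v B 1 0 * (a * mx v E 2 1 - e * mx v B 2 1) =
      (mx v B 2 1 * mx v B 1 0 * e + 2 * (mx v B 2 1 * mx v E 1 0 * a) + mx v E 2 1 * mx v B 1 0 * a)
      - 2 * mx v B 2 1 * (a * mx v E 1 0 - (- e * mx v B 1 0))"
      by (simp add: algebra_simps)
    ultimately have "mx v B 1 0 * (a * mx v E 2 1 - e * mx v B 2 1) = 0" unfolding i0 by simp
    then show ?thesis using nz[of 0] d by simp
  qed
  \<comment> \<open>The entry (j + 3, j) links three consecutive subdiagonal positions, so the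
    recursion needs two base cases. These are \<open>i0\<close> and \<open>i1\<close>, where the
    loop at 0 enters and the sign is decided.\<close>
  have sub: "a * mx v E (Suc i) i = - ((-1) ^ i) * e * mx v B (Suc i) i" if "i < d" for i
    using that
  proof (induction i rule: less_induct)
    case (less i)
    consider "i = 0" | "i = 1" | j where "i = Suc (Suc j)" by (metis One_nat_def not0_implies_Suc)
    then show ?case
    proof cases
      case 3
      define b0 b1 b2 where "b0 = mx v B (Suc j) j" and "b1 = mx v B (Suc (Suc j)) (Suc j)"
        and "b2 = mx v B (Suc (Suc (Suc j))) (Suc (Suc j))"
      define e0 e1 e2 where "e0 = mx v E (Suc j) j" and "e1 = mx v E (Suc (Suc j)) (Suc j)"
        and "e2 = mx v E (Suc (Suc (Suc j))) (Suc (Suc j))"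
      define \<sigma> :: 'k where "\<sigma> = (-1) ^ j"
      have j: "j + 3 \<le> d" using 3 less.prems by simp
      have "b2 * b1 * e0 + 2 * (b2 * e1 * b0) + e2 * b1 * b0 = 0"
        using mx0[of "Suc (Suc (Suc j))" j] ent[of "Suc (Suc (Suc j))" j] three_steps[OF B B E v j]
          three_steps[OF B E B v j] three_steps[OF E B B v j] j
          irred_far[OF anchored_irred[OF E(2)], of "Suc (Suc (Suc j))" j]
        by (simp add: b0_def b1_def b2_def e0_def e1_def e2_def)
      moreover have "a * e0 = - \<sigma> * e * b0" "a * e1 = \<sigma> * e * b1"
        using less.IH[of j] less.IH[of "Suc j"] 3 less.prems
        by (simp_all add: b0_def b1_def e0_def e1_def \<sigma>_def)
      moreover have "(b1 * b0) * (a * e2 + \<sigma> * e * b2) = a * (b2 * b1 * e0 + 2 * (b2 * e1 * b0) + e2 * b1 * b0)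
          - b2 * b1 * (a * e0 - (- \<sigma> * e * b0)) - 2 * b2 * b0 * (a * e1 - \<sigma> * e * b1)"
        by (simp add: algebra_simps)
      ultimately have "(b1 * b0) * (a * e2 + \<sigma> * e * b2) = 0" by simp
      moreover have "b0 \<noteq> 0" "b1 \<noteq> 0" using nz(1) 3 less.prems by (auto simp: b0_def b1_def)
      ultimately have "a * e2 = - \<sigma> * e * b2" by (simp add: eq_neg_iff_add_eq_0)
      then show ?thesis using 3 by (simp add: e2_def b2_def \<sigma>_def)
    qed (use i0 i1 in \<open>simp_all add: numeral_2_eq_2\<close>)
  qed
  show "mx v B 0 0 * mx v E (Suc i) i = - ((-1) ^ i) * mx v E 0 0 * mx v B (Suc i) i"
    using sub[OF i] by (simp add: a_def e_def)
  define \<sigma> :: 'k where "\<sigma> = (-1) ^ i"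
  have "\<sigma> * \<sigma> = 1" by (simp add: \<sigma>_def flip: power_mult_distrib)
  moreover have "a * mx v E (Suc i) i + \<sigma> * e * mx v B (Suc i) i = 0"
    unfolding sub[OF i] by (simp add: \<sigma>_def)
  moreover have "a\<^sup>2 * (mx v E (Suc i) i * mx v E i (Suc i)) = e\<^sup>2 * (mx v B (Suc i) i * mx v B i (Suc i))"
    using prod i by (simp add: a_def e_def)
  \<comment> \<open>The superdiagonal entry follows from the subdiagonal one and the known product
    of the two.\<close>
  moreover have "(e * mx v B (Suc i) i) * (a * mx v E i (Suc i) + \<sigma> * e * mx v B i (Suc i)) =
      - \<sigma> * (a\<^sup>2 * (mx v E (Suc i) i * mx v E i (Suc i)) - e\<^sup>2 * (mx v B (Suc i) i * mx v B i (Suc i)))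
      + \<sigma> * a * mx v E i (Suc i) * (a * mx v E (Suc i) i + \<sigma> * e * mx v B (Suc i) i)
      + (1 - \<sigma> * \<sigma>) * (e * mx v B (Suc i) i * a * mx v E i (Suc i))"
    by (simp add: power2_eq_square algebra_simps)
  ultimately have "(e * mx v B (Suc i) i) * (a * mx v E i (Suc i) + \<sigma> * e * mx v B i (Suc i)) = 0"
    by simp
  then have "a * mx v E i (Suc i) = - \<sigma> * e * mx v B i (Suc i)"
    using e nz(1)[OF i] by (simp add: eq_neg_iff_add_eq_0)
  then show "mx v B 0 0 * mx v E i (Suc i) = - ((-1) ^ i) * mx v E 0 0 * mx v B i (Suc i)"
    by (simp add: a_def e_def \<sigma>_def)
qed

section \<open>Canonical matrices of a triple\<close>

lemma almost_bipartite_iff: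
  assumes "irred u Y"
  shows "almost_bipartite_mat (matrix_of s V u Y) \<longleftrightarrow>
     (mx u Y 0 0 \<noteq> 0) \<noteq> (mx u Y d d \<noteq> 0) \<and> (\<forall>i. 1 \<le> i \<and> i < d \<longrightarrow> mx u Y i i = 0)"
  using assms by (auto simp: almost_bipartite_mat_def tridiagonal_mat_def matrix_of_dim matrix_of_index
      less_Suc_eq_le irred_def)

lemma almost_bipartite_anchored:
  assumes v: "basis v" and Y: "lin Y" and irr: "irred v Y" and ab: "almost_bipartite_mat (matrix_of s V v Y)"
  shows "anchored v Y \<or> anchored (reversed v) Y"
proof -
  have ends: "(mx v Y 0 0 \<noteq> 0) \<noteq> (mx v Y d d \<noteq> 0)" and mid: "1 \<le> i \<Longrightarrow> i < d \<Longrightarrow> mx v Y i i = 0" for i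
    using ab by (auto simp: almost_bipartite_iff[OF irr])
  show ?thesis
  proof (cases "mx v Y 0 0 = 0")
    case False
    then have "mx v Y i i = 0" if "i \<le> d" "0 < i" for i
      using ends mid[of i] that by (cases "i = d") auto
    then show ?thesis using False irr by (auto simp: anchored_def)
  next
    case True
    then have "mx v Y (d - i) (d - i) = 0" if "i \<le> d" "0 < i" for i
      using mid[of "d - i"] that by (cases "i = d") auto
    then have "anchored (reversed v) Y"
      using True ends irred_reversed[OF v Y irr] v Y by (auto simp: anchored_def mx_reversed)
    then show ?thesis ..
  qed
qed

lemma leonard_pairD:
  assumes "leonard_pair s V A B"
  obtains v w where "lin A" "lin B" "basis v" "diag_in v A (\<lambda>i. mx v A i i)" "irred v B"
    "basis w" "diag_in w B (\<lambda>i. mx w B i i)" "irred w A"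
  using assms by (auto simp: leonard_pair_def leonard_basis_iff)

text \<open>\<open>bannai_ito_pair\<close> gives the quotients for some Leonard basis; uniqueness up
  to scalars and reversal transports them to the given one.\<close>

lemma bannai_ito_gaps:
  assumes bi: "bannai_ito_pair s V A B" and v: "leonard_basis s V v A B"
  shows "alternating_gaps d (\<lambda>i. mx v A i i)"
proof -
  obtain w where lin: "lin A" "lin B" and w: "basis w" "irred w A"
    using bi leonard_pairD unfolding bannai_ito_pair_def by metis
  have v: "basis v" "diag_in v A (\<lambda>i. mx v A i i)" "irred v B"
    using v lin by (auto simp: leonard_basis_iff)
  obtain u where u: "leonard_basis s V u A B" and
    quot: "\<And>i. 2 \<le> i \<Longrightarrow> i \<le> d - 1 \<Longrightarrow> (matrix_of s V u A $$ (i - 2, i - 2) - matrix_of s V u A $$ (i + 1, i + 1)) /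
        (matrix_of s V u A $$ (i - 1, i - 1) - matrix_of s V u A $$ (i, i)) = -1"
    using bi unfolding bannai_ito_pair_def Let_def diam_V by blast
  define \<eta> where "\<eta> i = mx u A i i" for i
  have u: "basis u" "diag_in u A \<eta>" "irred u B"
    using u lin by (auto simp: leonard_basis_iff \<eta>_def[abs_def])
  have gap: "alternating_gaps d \<eta>"
    unfolding alternating_gaps_def
  proof (intro allI impI)
    fix i assume i: "i + 3 \<le> d"
    have "(\<eta> i - \<eta> (i + 3)) / (\<eta> (i + 1) - \<eta> (i + 2)) = -1"
      using quot[of "i + 2"] i by (simp add: matrix_of_index \<eta>_def numeral_3_eq_3)
    \<comment> \<open>As division by zero yields 0, the value -1 itself rules out a vanishing
      denominator.\<close>
    then have "\<eta> i - \<eta> (i + 3) = - (\<eta> (i + 1) - \<eta> (i + 2))"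
      by (cases "\<eta> (i + 1) - \<eta> (i + 2) = 0") (simp_all add: divide_eq_eq)
    then show "\<eta> i + \<eta> (i + 1) = \<eta> (i + 2) + \<eta> (i + 3)" by (simp add: algebra_simps)
  qed
  have inj: "inj_on \<eta> {..d}" by (rule multiplicity_free[OF u(1,2) w lin(1)])
  obtain c where c: "\<And>i. i \<le> d \<Longrightarrow> c i \<noteq> 0"
    and vu: "(\<forall>i\<le>d. v i = c i *s u i) \<or> (\<forall>i\<le>d. v i = c i *s reversed u i)"
    using leonard_basis_unique[OF lin u inj v] by blast
  have val: "mx v A i i = \<kappa> i" if "i \<le> d" "diag_in b A \<kappa>" "basis b" "v i = c i *s b i" for i b \<kappa>
  proof -
    have "A (v i) = c i *s \<kappa> i *s b i"
      unfolding that(4) using that lin by (simp only: lin_scale basis_in) (simp add: diag_in_def)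
    also have "\<dots> = \<kappa> i *s v i" unfolding that(4) by (simp add: mult.commute)
    finally show ?thesis using v(1) that(1) by (simp add: mx_def)
  qed
  show ?thesis
    using vu
  proof
    assume "\<forall>i\<le>d. v i = c i *s u i"
    then have "\<forall>i\<le>d. mx v A i i = \<eta> i" using val[OF _ u(2,1)] by blast
    then show ?thesis using gap by (simp add: alternating_gaps_def)
  next
    assume "\<forall>i\<le>d. v i = c i *s reversed u i"
    then have "\<forall>i\<le>d. mx v A i i = \<eta> (d - i)" using val[OF _ diag_in_reversed[OF u(2)] basis_reversed[OF u(1)]] by blast
    then show ?thesis using alternating_gaps_reverse[OF gap] by (simp add: alternating_gaps_def)
  qed
qed

text \<open>All that one ordered pair contributes to the canonical form, stated for a given
  \<open>v\<close> so that the contributions of two pairs can be required in the same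
  orientation.\<close>

definition bi_anchored :: "(nat \<Rightarrow> 'v) \<Rightarrow> ('v \<Rightarrow> 'v) \<Rightarrow> ('v \<Rightarrow> 'v) \<Rightarrow> bool" where
  "bi_anchored v X Y \<longleftrightarrow> basis v \<and> anchored v Y \<and>
     (\<exists>c. c \<noteq> 0 \<and> half_odd v X c \<and> (\<forall>x\<in>V. bracket 0 (4 * c\<^sup>2) X Y x = 0))"

lemma bi_anchored_orientation:
  assumes d: "d \<ge> 3" and bi: "bannai_ito_pair s V X Y" "bannai_ito_pair s V Y X"
    and v: "leonard_basis s V v X Y" "almost_bipartite_mat (matrix_of s V v Y)"
    and w: "leonard_basis s V w Y X" "almost_bipartite_mat (matrix_of s V w X)"
  shows "bi_anchored v X Y \<or> bi_anchored (reversed v) X Y"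
proof -
  have lin: "lin X" "lin Y"
    using bi by (auto simp: bannai_ito_pair_def leonard_pair_def)
  have oriented: "\<exists>u \<theta>. u \<in> {b, reversed b} \<and> basis u \<and> diag_in u F \<theta> \<and> anchored u G \<and> alternating_gaps d \<theta>"
    if FG: "lin F" "lin G" "bannai_ito_pair s V F G" "leonard_basis s V b F G"
      "almost_bipartite_mat (matrix_of s V b G)" for F G b
  proof -
    have b: "basis b" "diag_in b F (\<lambda>i. mx b F i i)" "irred b G"
      using FG by (auto simp: leonard_basis_iff)
    note gaps = bannai_ito_gaps[OF FG(3,4)]
    from almost_bipartite_anchored[OF b(1) FG(2) b(3) FG(5)] show ?thesis
    proof
      assume "anchored (reversed b) G"
      then show ?thesis
        using basis_reversed[OF b(1)] diag_in_reversed[OF b(2)] alternating_gaps_reverse[OF gaps] by blast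
    qed (use b gaps in blast)
  qed
  obtain v' \<theta> where v': "v' \<in> {v, reversed v}" "basis v'" "diag_in v' X \<theta>" "anchored v' Y" "alternating_gaps d \<theta>"
    using oriented[OF lin bi(1) v] by blast
  obtain w' \<eta> where w': "basis w'" "diag_in w' Y \<eta>" "anchored w' X" "alternating_gaps d \<eta>"
    using oriented[OF lin(2,1) bi(2) w] by blast
  note pair = anchored_pair[OF d lin v'(2-5) w']
  have "half_odd v' X (\<theta> 0)"
    using v'(3) pair(1) unfolding half_odd_def diag_in_def by metis
  then have "bi_anchored v' X Y" using v' pair(2,3) unfolding bi_anchored_def by blast
  then show ?thesis using v'(1) by blast
qed

text \<open>Comparing the eigenvalues at both ends would give c = (2 d + 1)^2 c. Thus the spectrum
  of \<open>X\<close> alone fixes the orientation of its eigenbasis, and the two other maps of a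
  triple are anchored at the same end.\<close>

lemma half_odd_reversed:
  assumes v: "basis v" and c: "half_odd v X c" "c \<noteq> 0" and c': "half_odd (reversed v) X c'" and d: "d \<ge> 1"
  shows False
proof -
  have eig: "\<kappa> = \<mu>" if "X x = \<kappa> *s x" "X x = \<mu> *s x" "x = v i" "i \<le> d" for \<kappa> \<mu> x i
    using that basis_nonzero[OF v] by (metis scale_cancel_right)
  have "c = (-1) ^ d * (2 * of_nat d + 1) * c'"
    using eig[of "v 0" c "(-1) ^ d * (2 * of_nat d + 1) * c'" 0] c c'
    by (auto simp: half_odd_def diag_in_def reversed_def)
  moreover have "(-1) ^ d * (2 * of_nat d + 1) * c = c'"
    using eig[of "v d" "(-1) ^ d * (2 * of_nat d + 1) * c" c' d] c c'
    by (auto simp: half_odd_def diag_in_def reversed_def)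
  ultimately have "c = ((-1) ^ d * (-1) ^ d) * (2 * of_nat d + 1)\<^sup>2 * c"
    by (metis (no_types, lifting) mult.assoc mult.left_commute power2_eq_square)
  then have "c * ((2 * of_nat d + 1)\<^sup>2 - 1) = 0" by (simp add: algebra_simps flip: power_mult_distrib)
  moreover have "(2 * of_nat d + 1)\<^sup>2 - 1 = 4 * (of_nat (d * (d + 1)) :: 'k)"
    by (simp add: power2_eq_square algebra_simps)
  ultimately have "of_nat (d * (d + 1)) = (0 :: 'k)" using c(2) by (metis mult_eq_0_iff zero_neq_numeral)
  then show False using d by (simp only: of_nat_eq_0_iff) simp
qed

lemma bi_anchored_both:
  assumes "bi_anchored v X Y \<or> bi_anchored (reversed v) X Y" "bi_anchored v X Z \<or> bi_anchored (reversed v) X Z" "d \<ge> 1" "basis v"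
  obtains u where "bi_anchored u X Y" "bi_anchored u X Z"
  using assms half_odd_reversed[OF \<open>basis v\<close> _ _ _ \<open>d \<ge> 1\<close>] unfolding bi_anchored_def by metis

lemma tab_triple_bi_anchored:
  assumes d: "d \<ge> 3" and tab: "totally_almost_bipartite s V A B E" and bi: "bannai_ito_triple s V A B E"
  obtains v w z where "bi_anchored v A B" "bi_anchored v A E" "bi_anchored w B E" "bi_anchored w B A" "bi_anchored z E A" "bi_anchored z E B"
    "lin A" "lin B" "lin E"
proof -
  have tri: "leonard_triple s V A B E" using tab by (simp add: totally_almost_bipartite_def)
  then have lin: "lin A" "lin B" "lin E" by (auto simp: leonard_triple_def)
  obtain v w z where v: "leonard_basis s V v A B" "leonard_basis s V v A E"
    and w: "leonard_basis s V w B E" "leonard_basis s V w B A"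
    and z: "leonard_basis s V z E A" "leonard_basis s V z E B"
    using tri by (auto simp: leonard_triple_def)
  have abv: "almost_bipartite_mat (matrix_of s V v B)" "almost_bipartite_mat (matrix_of s V v E)"
    and abw: "almost_bipartite_mat (matrix_of s V w E)" "almost_bipartite_mat (matrix_of s V w A)"
    and abz: "almost_bipartite_mat (matrix_of s V z A)" "almost_bipartite_mat (matrix_of s V z B)"
    using tab v w z unfolding totally_almost_bipartite_def by auto
  have bi: "bannai_ito_pair s V A B" "bannai_ito_pair s V B A" "bannai_ito_pair s V A E"
    "bannai_ito_pair s V E A" "bannai_ito_pair s V B E" "bannai_ito_pair s V E B"
    using bi by (auto simp: bannai_ito_triple_def)
  have bas: "basis v" "basis w" "basis z" and d1: "d \<ge> 1"
    using v w z d lin by (auto simp: leonard_basis_iff)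
  obtain v' where "bi_anchored v' A B" "bi_anchored v' A E"
    using bi_anchored_both[OF bi_anchored_orientation[OF d bi(1,2) v(1) abv(1) w(2) abw(2)]
      bi_anchored_orientation[OF d bi(3,4) v(2) abv(2) z(1) abz(1)] d1 bas(1)] by blast
  moreover obtain w' where "bi_anchored w' B E" "bi_anchored w' B A"
    using bi_anchored_both[OF bi_anchored_orientation[OF d bi(5,6) w(1) abw(1) z(2) abz(2)]
      bi_anchored_orientation[OF d bi(2,1) w(2) abw(2) v(1) abv(1)] d1 bas(2)] by blast
  moreover obtain z' where "bi_anchored z' E A" "bi_anchored z' E B"
    using bi_anchored_both[OF bi_anchored_orientation[OF d bi(4,3) z(1) abz(1) v(2) abv(2)]
      bi_anchored_orientation[OF d bi(6,5) z(2) abz(2) w(1) abw(1)] d1 bas(3)] by blast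
  ultimately show ?thesis using that lin by blast
qed

lemma bi_anchored_trace_nonzero:
  assumes "bi_anchored v X Y" "lin Y"
  shows "trace_on s V Y \<noteq> 0"
  using assms by (auto simp: bi_anchored_def trace_anchored) (simp add: anchored_def)

end

section \<open>Canonical matrices in terms of the traces\<close>

text \<open>The alternating sum of the odd numbers 1, ..., 2 d + 1 is
  \<open>(-1) ^ d * (of_nat d + 1)\<close>, so the trace \<open>\<tau>\<close> forces this
  eigenvalue at index 0 and with it all others.\<close>

definition std_diag :: "nat \<Rightarrow> 'k::field_char_0 \<Rightarrow> nat \<Rightarrow> nat \<Rightarrow> 'k" where
  "std_diag d \<tau> i j = (if i = j then (-1) ^ (i + d) * (2 * of_nat i + 1) * \<tau> / (of_nat d + 1) else 0)"

text \<open>Rescaling the basis turns the subdiagonal into 1, so the superdiagonal carries the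
  products from \<open>offdiag_products\<close>, with the constant of the relation expressed by the
  trace \<open>\<alpha>\<close>.\<close>

definition std_tridiag :: "nat \<Rightarrow> 'k::field_char_0 \<Rightarrow> nat \<Rightarrow> nat \<Rightarrow> 'k" where
  "std_tridiag d \<alpha> i j = (if i = 0 \<and> j = 0 then \<alpha> else if i = Suc j then 1
     else if j = Suc i then \<alpha>\<^sup>2 * ((of_nat d + 1)\<^sup>2 - (of_nat i + 1)\<^sup>2) / (of_nat d + 1)\<^sup>2 else 0)"

text \<open>\<open>min i j\<close> numbers the link between the neighbours i and j; the sign along
  it is the one found in \<open>third_offdiag\<close>.\<close>

definition std_third :: "nat \<Rightarrow> 'k::field_char_0 \<Rightarrow> 'k \<Rightarrow> nat \<Rightarrow> nat \<Rightarrow> 'k" where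
  "std_third d \<alpha> \<epsilon> i j = (if i = 0 \<and> j = 0 then \<epsilon> else - ((-1) ^ min i j) * (\<epsilon> / \<alpha>) * std_tridiag d \<alpha> i j)"

context fin_space_0
begin

lemma half_odd_unique:
  assumes "basis w" "half_odd w B c" "half_odd w B c'"
  shows "c = c'"
proof -
  have "B (w 0) = c *s w 0" "B (w 0) = c' *s w 0" using assms by (auto simp: half_odd_def diag_in_def)
  then show ?thesis using basis_nonzero[OF assms(1), of 0] by simp
qed

text \<open>The relations of \<open>B\<close> with \<open>A\<close> and of \<open>E\<close> with
  \<open>A\<close> determine the products of opposite entries of \<open>B\<close> and of
  \<open>E\<close>; the relation of \<open>B\<close> with \<open>E\<close> then determines the
  single entries of \<open>E\<close> relative to those of \<open>B\<close>.\<close>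

lemma canonical_form:
  assumes d: "d \<ge> 3" and tab: "totally_almost_bipartite s V A B E" and bi: "bannai_ito_triple s V A B E"
  obtains u where "basis u"
    "\<And>i j. i \<le> d \<Longrightarrow> j \<le> d \<Longrightarrow> mx u A i j = std_diag d (trace_on s V A) i j"
    "\<And>i j. i \<le> d \<Longrightarrow> j \<le> d \<Longrightarrow> mx u B i j = std_tridiag d (trace_on s V B) i j"
    "\<And>i j. i \<le> d \<Longrightarrow> j \<le> d \<Longrightarrow> mx u E i j = std_third d (trace_on s V B) (trace_on s V E) i j"
proof -
  obtain v w z where g: "bi_anchored v A B" "bi_anchored v A E" "bi_anchored w B E" "bi_anchored w B A" "bi_anchored z E A"
    and A: "lin A" and B: "lin B" and E: "lin E"
    using tab_triple_bi_anchored[OF assms] by metis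
  have v: "basis v" and vB: "anchored v B" and vE: "anchored v E"
    using g(1,2) by (auto simp: bi_anchored_def)
  obtain c where c: "c \<noteq> 0" "half_odd v A c" using g(1) by (auto simp: bi_anchored_def)
  obtain e where "half_odd w B e" and relBA: "\<forall>x\<in>V. bracket 0 (4 * e\<^sup>2) B A x = 0"
    using g(4) by (auto simp: bi_anchored_def)
  moreover obtain e' where "half_odd w B e'" and "\<forall>x\<in>V. bracket 0 (4 * e'\<^sup>2) B E x = 0"
    using g(3) by (auto simp: bi_anchored_def)
  moreover have "basis w" using g(3) by (simp add: bi_anchored_def)
  \<comment> \<open>Both constants come from the eigenvalue of \<open>B\<close> at
    \<open>w 0\<close>, so they agree; \<open>third_offdiag\<close> needs the constant that also
    governs the products of \<open>B\<close>.\<close>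
  ultimately have relBE: "\<forall>x\<in>V. bracket 0 (4 * e\<^sup>2) B E x = 0"
    using half_odd_unique by metis
  obtain f where relEA: "\<forall>x\<in>V. bracket 0 (4 * f\<^sup>2) E A x = 0"
    using g(5) by (auto simp: bi_anchored_def)
  define \<alpha> \<epsilon> D where "\<alpha> = mx v B 0 0" and "\<epsilon> = mx v E 0 0" and "D = (of_nat d + 1 :: 'k)"
  have D: "D \<noteq> 0" by (metis D_def of_nat_Suc of_nat_neq_0 add.commute)
  have d1: "d \<ge> 1" using d by simp
  note pB = offdiag_products[OF A B v c(2) vB c(1) d1 relBA, folded \<alpha>_def D_def]
    and pE = offdiag_products[OF A E v c(2) vE c(1) d1 relEA, folded \<epsilon>_def D_def]
  have nz: "\<alpha> \<noteq> 0" "\<epsilon> \<noteq> 0" using vB vE by (auto simp: anchored_def \<alpha>_def \<epsilon>_def)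
  have prodB: "mx v B (Suc i) i * mx v B i (Suc i) = \<alpha>\<^sup>2 * (D\<^sup>2 - (of_nat i + 1)\<^sup>2) / D\<^sup>2" if "i < d" for i
  proof -
    have "4 * (D\<^sup>2 * (mx v B (Suc i) i * mx v B i (Suc i))) = 4 * (\<alpha>\<^sup>2 * (D\<^sup>2 - (of_nat i + 1)\<^sup>2))"
    proof -
      have "4 * (D\<^sup>2 * (mx v B (Suc i) i * mx v B i (Suc i))) = (4 * e\<^sup>2 * D\<^sup>2) * (D\<^sup>2 - (of_nat i + 1)\<^sup>2)"
        using arg_cong[OF pB(2)[OF that], of "\<lambda>x. D\<^sup>2 * x"] by (simp only: mult_ac)
      then show ?thesis unfolding pB(1) by (simp only: mult_ac)
    qed
    then have "D\<^sup>2 * (mx v B (Suc i) i * mx v B i (Suc i)) = \<alpha>\<^sup>2 * (D\<^sup>2 - (of_nat i + 1)\<^sup>2)"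
      by (metis mult_left_cancel zero_neq_numeral)
    then show ?thesis using D by (simp add: eq_divide_eq mult.commute)
  qed
  have "\<alpha>\<^sup>2 * (mx v E (Suc i) i * mx v E i (Suc i)) = \<epsilon>\<^sup>2 * (mx v B (Suc i) i * mx v B i (Suc i))"
    if "i < d" for i
  proof -
    have "(4 * 4 * D\<^sup>2) * (\<alpha>\<^sup>2 * (mx v E (Suc i) i * mx v E i (Suc i))) =
      (4 * 4 * D\<^sup>2) * (\<epsilon>\<^sup>2 * (mx v B (Suc i) i * mx v B i (Suc i)))"
    proof -
      have "(4 * 4 * D\<^sup>2) * (\<alpha>\<^sup>2 * (mx v E (Suc i) i * mx v E i (Suc i))) =
          (4 * \<alpha>\<^sup>2) * D\<^sup>2 * (4 * (mx v E (Suc i) i * mx v E i (Suc i)))" by simp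
      also have "\<dots> = (4 * \<epsilon>\<^sup>2) * D\<^sup>2 * (4 * (mx v B (Suc i) i * mx v B i (Suc i)))"
        unfolding pB(2)[OF that] pE(2)[OF that] pB(1)[symmetric] pE(1)[symmetric] by (simp only: mult_ac)
      finally show ?thesis by simp
    qed
    then show ?thesis using D by (metis mult_left_cancel no_zero_divisors power_not_zero zero_neq_numeral)
  qed
  then have prod: "\<forall>i<d. \<alpha>\<^sup>2 * (mx v E (Suc i) i * mx v E i (Suc i)) = \<epsilon>\<^sup>2 * (mx v B (Suc i) i * mx v B i (Suc i))"
    by blast
  have "4 * e\<^sup>2 + 4 * (mx v B 1 0 * mx v B 0 1) = 4 * \<alpha>\<^sup>2"
    using pB(1) pB(2)[of 0] d by (simp add: algebra_simps)
  note third = third_offdiag[OF B vB E vE v d, folded \<alpha>_def \<epsilon>_def, OF prod this relBE]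
  \<comment> \<open>Scaling \<open>v i\<close> by the product of the first i subdiagonal entries
    makes every subdiagonal entry of \<open>B\<close> equal to 1.\<close>
  define k where "k i = (\<Prod>j<i. mx v B (Suc j) j)" for i
  have irrB: "irred v B" and irrE: "irred v E" using vB vE by (auto simp: anchored_def)
  have k_Suc: "k (Suc i) = k i * mx v B (Suc i) i" for i by (simp add: k_def)
  have k: "k i \<noteq> 0" if "i \<le> d" for i
    using irrB that by (auto simp: k_def irred_def)
  define u where "u i = k i *s v i" for i
  have id: "bij_betw (\<lambda>i. i) {..d} {..d}" by (simp add: bij_betw_def)
  have u: "basis u" by (rule basis_scale_permute[OF v id k]) (auto simp: u_def)
  have mxu: "mx u F i j = k j / k i * mx v F i j" if "lin F" "i \<le> d" "j \<le> d" for F i j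
    by (rule mx_scale_permute[OF v id k _ that]) (auto simp: u_def)
  have tr: "trace_on s V A = (-1) ^ d * D * c" "trace_on s V B = \<alpha>" "trace_on s V E = \<epsilon>"
    using trace_half_odd[OF v A c(2)] trace_anchored[OF v B vB] trace_anchored[OF v E vE]
    by (auto simp: D_def \<alpha>_def \<epsilon>_def)
  have cases: "P i j" if "i \<le> d" "j \<le> d" "P 0 0" "\<And>i. i < d \<Longrightarrow> P (Suc i) i" "\<And>i. i < d \<Longrightarrow> P i (Suc i)"
    "\<And>i j. i \<le> d \<Longrightarrow> j \<le> d \<Longrightarrow> (i \<noteq> 0 \<or> j \<noteq> 0) \<Longrightarrow> i \<noteq> Suc j \<Longrightarrow> j \<noteq> Suc i \<Longrightarrow> P i j" for P and i j :: nat
    using that by (metis Suc_le_lessD)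
  show ?thesis
  proof (rule that[OF u])
    show "mx u A i j = std_diag d (trace_on s V A) i j" if "i \<le> d" "j \<le> d" for i j
    proof -
      have "((-1) ^ d * (-1) ^ d :: 'k) = 1" by (simp flip: power_mult_distrib)
      then show ?thesis
        using that D k[OF that(1)] unfolding mxu[OF A that] tr std_diag_def D_def[symmetric]
        using c(2) by (auto simp: diag_in_mx[OF v] half_odd_def power_add mult.assoc)
    qed
    have far: "mx v F i j = 0" if "irred v F" "\<And>i. i \<le> d \<Longrightarrow> 0 < i \<Longrightarrow> mx v F i i = 0"
      "i \<le> d" "j \<le> d" "i \<noteq> 0 \<or> j \<noteq> 0" "i \<noteq> Suc j" "j \<noteq> Suc i" for F i j
      using that by (cases "i = j") (auto simp: irred_far)
    have sub: "mx u B (Suc i) i = 1" and sup: "mx u B i (Suc i) = mx v B (Suc i) i * mx v B i (Suc i)"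
      if i: "i < d" for i
      using mxu[OF B, of "Suc i" i] mxu[OF B, of i "Suc i"] i k[of i] k[of "Suc i"]
      by (auto simp: k_Suc)
    show stdB: "mx u B i j = std_tridiag d (trace_on s V B) i j" if "i \<le> d" "j \<le> d" for i j
      unfolding tr
    proof (rule cases[OF that])
      show "mx u B 0 0 = std_tridiag d \<alpha> 0 0" by (simp add: mxu[OF B] std_tridiag_def k \<alpha>_def)
      show "mx u B i j = std_tridiag d \<alpha> i j" if "i \<le> d" "j \<le> d" "i \<noteq> 0 \<or> j \<noteq> 0" "i \<noteq> Suc j" "j \<noteq> Suc i" for i j
        using far[OF irrB _ that] vB that by (auto simp: mxu[OF B] std_tridiag_def anchored_def)
    qed (simp_all add: sub sup prodB std_tridiag_def D_def)
    show "mx u E i j = std_third d (trace_on s V B) (trace_on s V E) i j" if "i \<le> d" "j \<le> d" for i j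
    proof (rule cases[OF that])
      show "mx u E 0 0 = std_third d (trace_on s V B) (trace_on s V E) 0 0"
        unfolding tr by (simp add: mxu[OF E] std_third_def k \<epsilon>_def)
      show "mx u E i j = std_third d (trace_on s V B) (trace_on s V E) i j"
        if "i \<le> d" "j \<le> d" "i \<noteq> 0 \<or> j \<noteq> 0" "i \<noteq> Suc j" "j \<noteq> Suc i" for i j
        using far[OF irrE _ that] vE that by (auto simp: mxu[OF E] std_third_def std_tridiag_def anchored_def)
      fix i assume i: "i < d"
      have "mx u E (Suc i) i = - ((-1) ^ i) * (\<epsilon> / \<alpha>) * mx u B (Suc i) i"
      proof -
        have "mx v E (Suc i) i = - ((-1) ^ i) * (\<epsilon> / \<alpha>) * mx v B (Suc i) i"
          using third(1)[OF i] nz by (simp add: field_simps)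
        then show ?thesis using i by (simp add: mxu[OF B] mxu[OF E] mult_ac)
      qed
      then show "mx u E (Suc i) i = std_third d (trace_on s V B) (trace_on s V E) (Suc i) i"
        using i by (simp add: stdB std_third_def tr)
      have "mx u E i (Suc i) = - ((-1) ^ i) * (\<epsilon> / \<alpha>) * mx u B i (Suc i)"
      proof -
        have "mx v E i (Suc i) = - ((-1) ^ i) * (\<epsilon> / \<alpha>) * mx v B i (Suc i)"
          using third(2)[OF i] nz by (simp add: field_simps)
        then show ?thesis using i by (simp add: mxu[OF B] mxu[OF E] mult_ac)
      qed
      then show "mx u E i (Suc i) = std_third d (trace_on s V B) (trace_on s V E) i (Suc i)"
        using i by (simp add: stdB std_third_def tr)
    qed
  qed
qed

end

lemma isomorphic_triples_matrices:
  assumes V: "fin_space s V d" and W: "fin_space t W d"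
    and v: "fin_space.basis s V d v" and w: "fin_space.basis t W d w"
    and lin: "linear_map_on s s V V A" "linear_map_on s s V V A'" "linear_map_on s s V V A''"
      "linear_map_on t t W W B" "linear_map_on t t W W B'" "linear_map_on t t W W B''"
    and eq: "\<And>i j. i \<le> d \<Longrightarrow> j \<le> d \<Longrightarrow> fin_space.mx s d v A i j = fin_space.mx t d w B i j"
      "\<And>i j. i \<le> d \<Longrightarrow> j \<le> d \<Longrightarrow> fin_space.mx s d v A' i j = fin_space.mx t d w B' i j"
      "\<And>i j. i \<le> d \<Longrightarrow> j \<le> d \<Longrightarrow> fin_space.mx s d v A'' i j = fin_space.mx t d w B'' i j"
  shows "isomorphic_triples s V A A' A'' t W B B' B''"
proof -
  interpret V: fin_space s V d by (rule V)
  interpret W: fin_space t W d by (rule W)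
  define \<phi> where "\<phi> x = (\<Sum>i\<le>d. t (V.crd v i x) (w i))" for x
  define \<psi> where "\<psi> y = (\<Sum>i\<le>d. s (W.crd w i y) (v i))" for y
  have \<phi>_in: "\<phi> x \<in> W" for x using w by (auto simp: \<phi>_def intro!: W.V_sum W.V_scale W.basis_in)
  have \<psi>_in: "\<psi> y \<in> V" for y using v by (auto simp: \<psi>_def intro!: V.V_sum V.V_scale V.basis_in)
  have crd_\<phi>: "W.crd w i (\<phi> x) = V.crd v i x" if "i \<le> d" for i x
    unfolding \<phi>_def by (rule W.crd_comb[OF w that])
  have crd_\<psi>: "V.crd v i (\<psi> x) = W.crd w i x" if "i \<le> d" for i x
    unfolding \<psi>_def by (rule V.crd_comb[OF v that])
  have "linear_map_on s t V W \<phi>"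
    unfolding linear_map_on_def
    using \<phi>_in v by (auto simp: \<phi>_def W.scale_left_distrib sum.distrib W.scale_sum_right)
  moreover have "bij_betw \<phi> V W"
  proof (rule bij_betwI[where g = \<psi>])
    show "\<psi> (\<phi> x) = x" if "x \<in> V" for x
      by (rule V.crd_eqI[OF v \<psi>_in that]) (simp add: crd_\<psi> crd_\<phi>)
    show "\<phi> (\<psi> y) = y" if "y \<in> W" for y
      by (rule W.crd_eqI[OF w \<phi>_in that]) (simp add: crd_\<psi> crd_\<phi>)
  qed (use \<phi>_in \<psi>_in in auto)
  moreover have "\<phi> (F x) = G (\<phi> x)"
    if x: "x \<in> V" and FG: "linear_map_on s s V V F" "linear_map_on t t W W G"
      "\<And>i j. i \<le> d \<Longrightarrow> j \<le> d \<Longrightarrow> V.mx v F i j = W.mx w G i j" for F G x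
  proof (rule W.crd_eqI[OF w \<phi>_in W.lin_in[OF FG(2) \<phi>_in]])
    fix i assume i: "i \<le> d"
    show "W.crd w i (\<phi> (F x)) = W.crd w i (G (\<phi> x))"
      using i FG(3) by (simp add: crd_\<phi> V.crd_apply[OF FG(1) v x] W.crd_apply[OF FG(2) w \<phi>_in])
  qed
  ultimately show ?thesis
    unfolding isomorphic_triples_def using lin eq by blast
qed

section \<open>Ladder operators and existence\<close>

context fin_space_0
begin

lemma eigenvectors_basis:
  assumes X: "lin X" and u: "\<And>i. i \<le> d \<Longrightarrow> u i \<in> V" "\<And>i. i \<le> d \<Longrightarrow> u i \<noteq> 0"
    and eig: "diag_in u X \<theta>" and inj: "inj_on \<theta> {..d}"
  shows "basis u"
proof (rule basisI[OF u(1)])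
  have "(\<Sum>i\<in>S. c i *s u i) = 0 \<Longrightarrow> \<forall>i\<in>S. c i = 0" if "finite S" "S \<subseteq> {..d}" for S c
    using that
  proof (induction S arbitrary: c rule: finite_induct)
    case (insert j S)
    have Xu: "X (c i *s u i) = (c i * \<theta> i) *s u i" if "i \<in> insert j S" for i
      using that insert.prems X u eig by (auto simp: lin_scale diag_in_def)
    have "X (\<Sum>i\<in>insert j S. c i *s u i) = (\<Sum>i\<in>insert j S. X (c i *s u i))"
      using insert.prems u by (intro lin_sum[OF X] V_scale) auto
    also have "\<dots> = (\<Sum>i\<in>insert j S. (c i * \<theta> i) *s u i)" using Xu by (rule sum.cong[OF refl])
    finally have "0 = (\<Sum>i\<in>insert j S. (c i * \<theta> i) *s u i) - \<theta> j *s (\<Sum>i\<in>insert j S. c i *s u i)"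
      unfolding insert.prems(1) by (simp add: lin_zero[OF X])
    also have "\<dots> = (\<Sum>i\<in>insert j S. (c i * (\<theta> i - \<theta> j)) *s u i)"
      unfolding scale_sum_right sum_subtractf[symmetric]
      by (rule sum.cong[OF refl]) (simp add: algebra_simps)
    also have "\<dots> = (\<Sum>i\<in>S. (c i * (\<theta> i - \<theta> j)) *s u i)"
      using insert.hyps by simp
    finally have "\<forall>i\<in>S. c i * (\<theta> i - \<theta> j) = 0"
      using insert.IH[of "\<lambda>i. c i * (\<theta> i - \<theta> j)"] insert.prems by auto
    moreover have "\<theta> i \<noteq> \<theta> j" if "i \<in> S" for i
      using inj_onD[OF inj, of i j] insert.hyps insert.prems that by auto
    ultimately have S: "\<forall>i\<in>S. c i = 0" by simp
    then have "c j *s u j = 0" using insert.prems insert.hyps by simp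
    then show ?case using S u(2)[of j] insert.prems by auto
  qed simp
  then show "\<forall>i\<le>d. c i = 0" if "(\<Sum>i\<le>d. c i *s u i) = 0" for c
    using that by (metis atMost_iff finite_atMost order_refl)
qed

text \<open>Squaring removes the signs, and characteristic zero turns the equation into one between
  natural numbers.\<close>

lemma sign_half_inj:
  fixes \<delta> \<delta>' :: 'k
  assumes "\<delta> * (2 * of_nat m + 1) = \<delta>' * (2 * of_nat n + 1)" "\<delta>\<^sup>2 = 1" "\<delta>'\<^sup>2 = 1"
  shows "m = n"
proof -
  have "(\<delta> * of_nat (2 * m + 1))\<^sup>2 = (\<delta>' * of_nat (2 * n + 1))\<^sup>2" using assms(1) by (simp add: add.commute)
  then have "(of_nat ((2 * m + 1)\<^sup>2) :: 'k) = of_nat ((2 * n + 1)\<^sup>2)"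
    unfolding power_mult_distrib assms(2,3) by (simp only: of_nat_power mult_1)
  then have "(2 * m + 1)\<^sup>2 = (2 * n + 1)\<^sup>2" by (simp only: of_nat_eq_iff)
  then show ?thesis by (simp add: power2_eq_iff_nonneg)
qed

lemma half_odd_inj:
  assumes "c \<noteq> 0"
  shows "inj_on (\<lambda>i. (-1) ^ i * (2 * of_nat i + 1) * c :: 'k) {..d}"
  using assms sign_half_inj[of "(-1) ^ _" _ "(-1) ^ _"]
  by (auto intro!: inj_onI simp flip: power_mult)

definition ladder :: "('v \<Rightarrow> 'v) \<Rightarrow> ('v \<Rightarrow> 'v) \<Rightarrow> 'k \<Rightarrow> 'v \<Rightarrow> 'v" where
  "ladder Y Z \<delta> x = Y x + \<delta> *s Z x"

lemma lin_ladder: "lin Y \<Longrightarrow> lin Z \<Longrightarrow> lin (ladder Y Z \<delta>)"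
  unfolding linear_map_on_def ladder_def
  by (auto simp: scale_right_distrib algebra_simps)

text \<open>The relations say that X + l exchanges \<open>Y x\<close> and \<open>Z x\<close>, so
  \<open>Y x + \<delta> *s Z x\<close> belongs to the eigenvalue \<open>\<delta>\<close> of this
  exchange.\<close>

lemma ladder_eigenvalue:
  assumes lin: "lin X" "lin Y" "lin Z"
    and rel: "X (Y x) + Y (X x) = Z x" "Z (X x) + X (Z x) = Y x"
    and x: "x \<in> V" "X x = l *s x" and \<delta>: "\<delta>\<^sup>2 = 1"
  shows "X (ladder Y Z \<delta> x) = (\<delta> - l) *s ladder Y Z \<delta> x"
proof -
  have "X (Y x) = Z x - l *s Y x" "X (Z x) = Y x - l *s Z x"
    using rel x lin by (auto simp: lin_scale eq_diff_eq add.commute)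
  then have "X (ladder Y Z \<delta> x) = (Z x - l *s Y x) + \<delta> *s (Y x - l *s Z x)"
    using x lin by (simp add: ladder_def lin_add lin_scale)
  also have "Z x = (\<delta> * \<delta>) *s Z x" using \<delta> by (simp add: power2_eq_square)
  then have "(Z x - l *s Y x) + \<delta> *s (Y x - l *s Z x) = ((\<delta> * \<delta>) *s Z x - l *s Y x) + \<delta> *s (Y x - l *s Z x)"
    by simp
  also have "\<dots> = (\<delta> - l) *s ladder Y Z \<delta> x"
    by (simp add: ladder_def algebra_simps)
  finally show ?thesis .
qed

text \<open>Expanding the square gives Y^2 + Z^2 from the squares and \<open>\<delta>\<close> times
  YZ + ZY from the cross terms, that is, C - X^2 + \<open>\<delta>\<close> X.\<close>

lemma ladder_square:
  assumes lin: "lin X" "lin Y" "lin Z"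
    and rel: "Y (Z x) + Z (Y x) = X x" "X (X x) + Y (Y x) + Z (Z x) = C *s x"
    and x: "x \<in> V" "X x = l *s x" and \<delta>: "\<delta>\<^sup>2 = 1"
  shows "ladder Y Z \<delta> (ladder Y Z \<delta> x) = (C - l\<^sup>2 + \<delta> * l) *s x"
proof -
  have "X (X x) = l\<^sup>2 *s x" using x lin by (simp add: lin_scale power2_eq_square)
  then have sq: "Y (Y x) + Z (Z x) = C *s x - l\<^sup>2 *s x" using rel(2) by (simp add: algebra_simps)
  have "ladder Y Z \<delta> (ladder Y Z \<delta> x) = Y (Y x) + \<delta>\<^sup>2 *s Z (Z x) + \<delta> *s (Y (Z x) + Z (Y x))"
    using x lin by (simp add: ladder_def lin_add lin_scale scale_right_distrib power2_eq_square)
  also have "\<dots> = (C - l\<^sup>2 + \<delta> * l) *s x"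
    unfolding rel(1) x(2) using sq \<delta> by (simp add: scale_left_distrib scale_left_diff_distrib)
  finally show ?thesis .
qed

text \<open>At index 0 the descending step returns to the line of \<open>u 0\<close> instead of
  going lower. This is the source of the single diagonal entry \<open>p 0 * k\<close>.\<close>

lemma anchored_ladder:
  assumes u: "basis u" and F: "lin F" and k: "k \<noteq> 0" and p: "\<And>j. j \<le> d \<Longrightarrow> p j \<noteq> 0"
    and q: "\<And>j. j < d \<Longrightarrow> q j \<noteq> 0" and d: "d \<ge> 1"
    and Fu: "\<And>j. j \<le> d \<Longrightarrow> F (u j) = p j *s (if j = 0 then k *s u 0 else u (j - 1)) +
       (if j < d then q j *s u (Suc j) else 0)"
  shows "anchored u F"
proof -
  have mx: "mx u F i j = p j * (if j = 0 then (if i = 0 then k else 0) else if Suc i = j then 1 else 0) +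
      (if j < d \<and> i = Suc j then q j else 0)" if "i \<le> d" "j \<le> d" for i j
    using u that d by (cases j) (auto simp: mx_def Fu)
  have "irred u F"
    unfolding irred_def using p q by (auto simp: mx split: if_splits)
  then show ?thesis
    unfolding anchored_def using p k d by (auto simp: mx)
qed

text \<open>For \<open>X x = \<lambda>x\<close> and \<open>\<delta> = \<plusminus>1\<close> the relations turn \<open>Y + \<delta>Z\<close> into a map from the eigenspace of
  \<open>\<lambda>\<close> to that of \<open>\<delta> - \<lambda>\<close> whose square is a scalar. Starting from the extreme eigenvalue one thus
  runs through \<open>\<plusminus>(i + 1/2)\<close>, \<open>0 \<le> i \<le> d\<close>, and is stuck at \<open>\<plusminus>1/2\<close>, which is the only place where
  the other two maps have a diagonal entry.\<close>

lemma ladder_basis: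
  fixes \<sigma> :: 'k
  assumes lin: "lin X" "lin Y" "lin Z" and d: "d \<ge> 1"
    and XY: "\<And>x. x \<in> V \<Longrightarrow> X (Y x) + Y (X x) = Z x"
    and YZ: "\<And>x. x \<in> V \<Longrightarrow> Y (Z x) + Z (Y x) = X x"
    and ZX: "\<And>x. x \<in> V \<Longrightarrow> Z (X x) + X (Z x) = Y x"
    and cas: "\<And>x. x \<in> V \<Longrightarrow> X (X x) + Y (Y x) + Z (Z x) = ((of_nat d + 1)\<^sup>2 - 1 / 4) *s x"
    and top: "t \<in> V" "t \<noteq> 0" "X t = (\<sigma> * (of_nat d + 1 / 2)) *s t" and \<sigma>: "\<sigma>\<^sup>2 = 1"
  obtains u c where "basis u" "c \<noteq> 0" "half_odd u X c" "anchored u Y" "anchored u Z"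
proof -
  \<comment> \<open>The signs alternate and end with \<open>\<delta> d = \<sigma>\<close>, matching
    the given extreme eigenvalue. Then
    \<open>\<delta> (Suc i) - \<theta> (Suc i) = \<theta> i\<close>, so the ladder of sign
    \<open>\<delta> (Suc i)\<close> descends from \<open>Suc i\<close> to \<open>i\<close>.\<close>
  define \<delta> :: "nat \<Rightarrow> 'k" where "\<delta> i = \<sigma> * (-1) ^ d * (-1) ^ i" for i
  define \<theta> where "\<theta> i = \<delta> i * (of_nat i + 1 / 2)" for i
  have \<delta>2: "(\<delta> i)\<^sup>2 = 1" for i
    using \<sigma> by (simp add: \<delta>_def power_mult_distrib flip: power_mult)
  have \<delta>_Suc: "\<delta> (Suc i) = - \<delta> i" for i by (simp add: \<delta>_def)
  have \<delta>_d: "\<delta> d = \<sigma>" by (simp add: \<delta>_def mult.assoc flip: power_mult_distrib)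
  let ?L = "ladder Y Z"
  have L: "lin (?L e)" for e using lin_ladder[OF lin(2,3)] .
  define f where "f = rec_nat t (\<lambda>n x. ?L (\<delta> (d - n)) x)"
  define u where "u i = f (d - i)" for i
  have u_d: "u d = t" by (simp add: u_def f_def)
  have down: "u i = ?L (\<delta> (Suc i)) (u (Suc i))" if "i < d" for i
  proof -
    have "d - i = Suc (d - Suc i)" "d - (d - Suc i) = Suc i" using that by auto
    then show ?thesis by (simp add: u_def f_def)
  qed
  have inV: "u i \<in> V" and Xu: "X (u i) = \<theta> i *s u i" and nz: "u i \<noteq> 0" if "i \<le> d" for i
  proof -
    have "u i \<in> V \<and> X (u i) = \<theta> i *s u i \<and> u i \<noteq> 0" using that
    proof (induction i rule: inc_induct)
      case base
      then show ?case using top by (simp add: u_d \<theta>_def \<delta>_d)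
    next
      case (step i)
      have "X (u i) = (\<delta> (Suc i) - \<theta> (Suc i)) *s u i"
        unfolding down[OF step(2)]
        using ladder_eigenvalue[OF lin XY ZX _ _ \<delta>2, of "u (Suc i)" "\<theta> (Suc i)" "Suc i"] step by blast
      moreover have "\<delta> (Suc i) - \<theta> (Suc i) = \<theta> i" by (simp add: \<theta>_def \<delta>_Suc algebra_simps)
      moreover have "u i \<noteq> 0"
      proof
        \<comment> \<open>Applying the descending ladder twice multiplies \<open>u (Suc i)\<close>
          by (d + 1)^2 - (i + 1)^2, which is nonzero for i < d.\<close>
        assume "u i = 0"
        then have "0 = ?L (\<delta> (Suc i)) (?L (\<delta> (Suc i)) (u (Suc i)))"
          using down[OF step(2)] lin_zero[OF L] by simp
        also have "\<dots> = ((of_nat d + 1)\<^sup>2 - 1 / 4 - (\<theta> (Suc i))\<^sup>2 + \<delta> (Suc i) * \<theta> (Suc i)) *s u (Suc i)"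
          using ladder_square[OF lin YZ cas _ _ \<delta>2, of "u (Suc i)" "\<theta> (Suc i)" "Suc i"] step by blast
        also have "(\<theta> (Suc i))\<^sup>2 = (of_nat (Suc i) + 1 / 2)\<^sup>2"
          unfolding \<theta>_def power_mult_distrib \<delta>2 by simp
        also have "\<delta> (Suc i) * \<theta> (Suc i) = of_nat (Suc i) + 1 / 2"
          unfolding \<theta>_def using \<delta>2[of "Suc i"] by (simp add: power2_eq_square flip: mult.assoc)
        finally have "(of_nat d + 1)\<^sup>2 - 1 / 4 - (of_nat (Suc i) + 1 / 2)\<^sup>2 + (of_nat (Suc i) + 1 / 2) = (0 :: 'k)"
          using step by simp
        then have "(of_nat ((d + 1)\<^sup>2) :: 'k) = of_nat ((Suc i)\<^sup>2)"
          by (simp add: power2_eq_square algebra_simps)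
        then have "(d + 1)\<^sup>2 = (Suc i)\<^sup>2" by (simp only: of_nat_eq_iff)
        then show False using step(2) by (simp add: power2_eq_iff_nonneg)
      qed
      moreover have "u i \<in> V" unfolding down[OF step(2)] using step L by simp
      ultimately show ?case by simp
    qed
    then show "u i \<in> V" "X (u i) = \<theta> i *s u i" "u i \<noteq> 0" by auto
  qed
  \<comment> \<open>The scalar of the squared ladder at \<open>u i\<close>. The value (d + 1)^2 -
    1/4 of X^2 + Y^2 + Z^2 makes it vanish at i = d + 1 and at no smaller index.\<close>
  define \<mu> where "\<mu> i = ((of_nat d + 1)\<^sup>2 - (of_nat i)\<^sup>2 :: 'k)" for i
  have \<mu>_nz: "\<mu> i \<noteq> 0" if "i \<le> d" for i
  proof
    assume "\<mu> i = 0"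
    then have "(of_nat ((d + 1)\<^sup>2) :: 'k) = of_nat (i\<^sup>2)" by (simp add: \<mu>_def add.commute)
    then have "(d + 1)\<^sup>2 = i\<^sup>2" by (simp only: of_nat_eq_iff)
    then show False using that by (simp add: power2_eq_iff_nonneg)
  qed
  have sq: "?L (\<delta> i) (?L (\<delta> i) (u i)) = \<mu> i *s u i" if "i \<le> d" for i
  proof -
    have "?L (\<delta> i) (?L (\<delta> i) (u i)) = ((of_nat d + 1)\<^sup>2 - 1 / 4 - (\<theta> i)\<^sup>2 + \<delta> i * \<theta> i) *s u i"
      using ladder_square[OF lin YZ cas _ _ \<delta>2, of "u i" "\<theta> i" i] inV Xu that by blast
    also have "(\<theta> i)\<^sup>2 = (of_nat i + 1 / 2)\<^sup>2"
      unfolding \<theta>_def power_mult_distrib \<delta>2 by simp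
    also have "\<delta> i * \<theta> i = of_nat i + 1 / 2"
      unfolding \<theta>_def using \<delta>2[of i] by (simp add: power2_eq_square flip: mult.assoc)
    also have "(of_nat d + 1)\<^sup>2 - 1 / 4 - (of_nat i + 1 / 2)\<^sup>2 + (of_nat i + 1 / 2) = \<mu> i"
      by (simp add: \<mu>_def power2_eq_square algebra_simps)
    finally show ?thesis .
  qed
  define c where "c = \<delta> 0 / 2"
  have c: "c \<noteq> 0" using \<delta>2[of 0] by (auto simp: c_def)
  have \<theta>_eq: "\<theta> = (\<lambda>i. (-1) ^ i * (2 * of_nat i + 1) * c)"
    by (auto simp: \<theta>_def c_def \<delta>_def field_simps)
  have ho: "half_odd u X c"
    using Xu by (simp add: half_odd_def diag_in_def \<theta>_eq)
  have diag: "diag_in u X \<theta>" using Xu by (simp add: diag_in_def)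
  have inj: "inj_on \<theta> {..d}" unfolding \<theta>_eq by (rule half_odd_inj[OF c])
  have bas: "basis u" by (rule eigenvectors_basis[OF lin(1) inV nz diag inj])
  have up: "?L (- \<delta> i) (u i) = \<mu> (Suc i) *s u (Suc i)" if "i < d" for i
    using sq[of "Suc i"] down[OF that] that by (simp add: \<delta>_Suc)
  \<comment> \<open>A nonzero image would have the eigenvalue that the formula for
    \<open>\<theta>\<close> gives at d + 1, but no eigenvalue of \<open>X\<close> has that absolute
    value.\<close>
  have up_d: "?L (- \<delta> d) (u d) = 0"
  proof (rule ccontr)
    assume z: "?L (- \<delta> d) (u d) \<noteq> 0"
    have "X (?L (- \<delta> d) (u d)) = (- \<delta> d - \<theta> d) *s ?L (- \<delta> d) (u d)"
      using ladder_eigenvalue[OF lin XY ZX, of "u d" "\<theta> d" "- \<delta> d"] inV Xu \<delta>2 by simp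
    then obtain j where j: "j \<le> d" "- \<delta> d - \<theta> d = \<theta> j"
      using eigenvector_unique[OF lin(1) bas diag inj _ _ z] L inV by (metis le_refl lin_in)
    have "\<delta> (Suc d) * (2 * of_nat (Suc d) + 1) = 2 * (- \<delta> d - \<theta> d)"
      by (simp add: \<delta>_Suc \<theta>_def algebra_simps)
    also have "\<dots> = \<delta> j * (2 * of_nat j + 1)" unfolding j(2) by (simp add: \<theta>_def algebra_simps)
    finally have "Suc d = j" by (rule sign_half_inj[OF _ \<delta>2 \<delta>2])
    then show False using j by simp
  qed
  obtain k where k: "k \<noteq> 0" "?L (\<delta> 0) (u 0) = k *s u 0"
  proof -
    have z: "?L (\<delta> 0) (u 0) \<noteq> 0"
    proof
      assume "?L (\<delta> 0) (u 0) = 0"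
      then have "\<mu> 0 *s u 0 = 0" using sq[of 0] lin_zero[OF L] by simp
      then show False using \<mu>_nz[of 0] nz[of 0] by simp
    qed
    have "X (?L (\<delta> 0) (u 0)) = (\<delta> 0 - \<theta> 0) *s ?L (\<delta> 0) (u 0)"
      using ladder_eigenvalue[OF lin XY ZX, of "u 0" "\<theta> 0" "\<delta> 0"] inV Xu \<delta>2 by simp
    also have "\<delta> 0 - \<theta> 0 = \<theta> 0" by (simp add: \<theta>_def)
    finally obtain j where j: "j \<le> d" "\<theta> 0 = \<theta> j" "crd u j (?L (\<delta> 0) (u 0)) \<noteq> 0"
      "?L (\<delta> 0) (u 0) = crd u j (?L (\<delta> 0) (u 0)) *s u j"
      using eigenvector_unique[OF lin(1) bas diag inj _ _ z] L inV by (metis le0 lin_in)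
    then have "j = 0" using inj by (auto dest: inj_onD)
    then show ?thesis using j that by blast
  qed
  have dn: "?L (\<delta> j) (u j) = (if j = 0 then k *s u 0 else u (j - 1))" if "j \<le> d" for j
    using that k(2) down[of "j - 1"] by (cases j) auto
  have up': "?L (- \<delta> j) (u j) = (if j < d then \<mu> (Suc j) *s u (Suc j) else 0)" if "j \<le> d" for j
    using that up up_d by auto
  \<comment> \<open>\<open>Y\<close> and \<open>Z\<close> are recovered from the descending ladder,
    of sign \<open>\<delta> j\<close>, and the ascending one, of sign
    \<open>- \<delta> j\<close>.\<close>
  have halves: "Y x = (1/2) *s ?L (\<delta> j) x + (1/2) *s ?L (- \<delta> j) x"
    "Z x = (\<delta> j / 2) *s ?L (\<delta> j) x + (- \<delta> j / 2) *s ?L (- \<delta> j) x" for x j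
  proof -
    have "(1/2) *s ?L (\<delta> j) x + (1/2) *s ?L (- \<delta> j) x = (1/2 + 1/2) *s Y x"
      unfolding scale_left_distrib by (simp add: ladder_def scale_right_distrib scale_right_diff_distrib)
    then show "Y x = (1/2) *s ?L (\<delta> j) x + (1/2) *s ?L (- \<delta> j) x" by simp
    have "(\<delta> j / 2) *s ?L (\<delta> j) x + (- \<delta> j / 2) *s ?L (- \<delta> j) x = (\<delta> j / 2 * \<delta> j + \<delta> j / 2 * \<delta> j) *s Z x"
      unfolding scale_left_distrib by (simp add: ladder_def scale_right_distrib scale_right_diff_distrib)
    then show "Z x = (\<delta> j / 2) *s ?L (\<delta> j) x + (- \<delta> j / 2) *s ?L (- \<delta> j) x"
      using \<delta>2[of j] by (simp add: power2_eq_square)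
  qed
  have \<delta>_nz: "\<delta> j \<noteq> 0" for j using \<delta>2[of j] by auto
  have "anchored u Y"
  proof (rule anchored_ladder[OF bas lin(2) k(1), where p = "\<lambda>_. 1/2" and q = "\<lambda>j. 1/2 * \<mu> (Suc j)"])
    show "Y (u j) = (1/2) *s (if j = 0 then k *s u 0 else u (j - 1)) +
        (if j < d then (1/2 * \<mu> (Suc j)) *s u (Suc j) else 0)" if "j \<le> d" for j
      by (subst halves(1)[of _ j]) (simp add: dn[OF that] up'[OF that])
  qed (use \<mu>_nz d in auto)
  moreover have "anchored u Z"
  proof (rule anchored_ladder[OF bas lin(3) k(1), where p = "\<lambda>j. \<delta> j / 2" and q = "\<lambda>j. - \<delta> j / 2 * \<mu> (Suc j)"])
    show "Z (u j) = (\<delta> j / 2) *s (if j = 0 then k *s u 0 else u (j - 1)) +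
        (if j < d then (- \<delta> j / 2 * \<mu> (Suc j)) *s u (Suc j) else 0)" if "j \<le> d" for j
      by (subst halves(2)[of _ j]) (simp add: dn[OF that] up'[OF that])
  qed (use \<mu>_nz \<delta>_nz d in auto)
  ultimately show ?thesis using that bas c ho by blast
qed

section \<open>From anchored eigenbases back to the defining properties of the triple\<close>

text \<open>\<open>totally_almost_bipartite\<close> speaks of every Leonard basis, while a
  construction supplies one; the others arise from it by scalars and reversal, which keep the
  diagonal entries up to order.\<close>

lemma anchored_leonard_basis_bipartite:
  assumes X: "lin X" and Y: "lin Y" and d: "d \<ge> 1"
    and v: "basis v" "half_odd v X c" "c \<noteq> 0" "anchored v Y" and u: "leonard_basis s V u X Y"
  shows "almost_bipartite_mat (matrix_of s V u Y)"
proof -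
  have u: "basis u" "diag_in u X (\<lambda>i. mx u X i i)" "irred u Y"
    using u X by (auto simp: leonard_basis_iff)
  obtain a where a: "\<And>i. i \<le> d \<Longrightarrow> a i \<noteq> 0"
    and uv: "(\<forall>i\<le>d. u i = a i *s v i) \<or> (\<forall>i\<le>d. u i = a i *s reversed v i)"
    using leonard_basis_unique[OF X Y v(1) v(2)[unfolded half_odd_def] anchored_irred[OF v(4)] half_odd_inj[OF v(3)] u]
    by blast
  have ab: "mx v Y 0 0 \<noteq> 0" "\<And>i. i \<le> d \<Longrightarrow> 0 < i \<Longrightarrow> mx v Y i i = 0"
    using v(4) by (auto simp: anchored_def)
  show ?thesis
    unfolding almost_bipartite_iff[OF u(3)]
    using uv
  proof
    assume "\<forall>i\<le>d. u i = a i *s v i"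
    then have u_eq: "\<And>i. i \<le> d \<Longrightarrow> u i = a i *s v i" by blast
    have "bij_betw (\<lambda>i. i) {..d} {..d}" by (simp add: bij_betw_def)
    then have "mx u Y i i = mx v Y i i" if "i \<le> d" for i
      using mx_scale_permute[OF v(1) _ a u_eq Y that that] a[OF that] by simp
    then show "(mx u Y 0 0 \<noteq> 0) \<noteq> (mx u Y d d \<noteq> 0) \<and> (\<forall>i. 1 \<le> i \<and> i < d \<longrightarrow> mx u Y i i = 0)"
      using ab d by simp
  next
    assume "\<forall>i\<le>d. u i = a i *s reversed v i"
    then have u_eq: "\<And>i. i \<le> d \<Longrightarrow> u i = a i *s v (d - i)" by (simp add: reversed_def)
    have "mx u Y i i = mx v Y (d - i) (d - i)" if "i \<le> d" for i
      using mx_scale_permute[OF v(1) bij_betw_reverse a u_eq Y that that] a[OF that] by simp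
    then show "(mx u Y 0 0 \<noteq> 0) \<noteq> (mx u Y d d \<noteq> 0) \<and> (\<forall>i. 1 \<le> i \<and> i < d \<longrightarrow> mx u Y i i = 0)"
      using ab d by simp
  qed
qed

lemma fin_dim_pos_V: "fin_dim_pos s V"
proof -
  obtain v where v: "basis v" using ex_basis unfolding basis_def by blast
  then have "v 0 \<in> V" "v 0 \<noteq> 0" using basis_nonzero by auto
  moreover have "finite (v ` {..d}) \<and> span (v ` {..d}) = V" using v by (simp add: basis_def)
  ultimately show ?thesis unfolding fin_dim_pos_def using subspace_V by blast
qed

lemma half_odd_leonard:
  assumes "lin X" "basis v" "half_odd v X c" "anchored v Y"
  shows "leonard_basis s V v X Y"
proof -
  have "diag_in v X (\<lambda>i. mx v X i i)"
    using assms(3) diag_in_mx[OF assms(2) assms(3)[unfolded half_odd_def]]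
    by (simp add: half_odd_def diag_in_def)
  then show ?thesis
    unfolding leonard_basis_iff[OF assms(1)] using assms(2,4) by (simp add: anchored_def)
qed

lemma half_odd_quotient:
  assumes v: "basis v" "half_odd v X c" "c \<noteq> 0" and i: "2 \<le> i" "i \<le> d - 1"
  shows "(matrix_of s V v X $$ (i - 2, i - 2) - matrix_of s V v X $$ (i + 1, i + 1)) /
    (matrix_of s V v X $$ (i - 1, i - 1) - matrix_of s V v X $$ (i, i)) = -1"
proof -
  obtain j where j: "i = j + 2" using i by (metis add.commute le_Suc_ex)
  have mx: "matrix_of s V v X $$ (k, k) = (-1) ^ k * (2 * of_nat k + 1) * c" if "k \<le> d" for k
    using diag_in_mx[OF v(1) v(2)[unfolded half_odd_def] that that] that by (simp add: matrix_of_index)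
  \<comment> \<open>Signs at odd distance are opposite, so both differences become sums of odd
    numbers: (2 j + 1) + (2 j + 7) and (2 j + 3) + (2 j + 5).\<close>
  define m where "m = (-1) ^ j * (4 * (of_nat (j + 2) * c))"
  have "(of_nat (j + 2) :: 'k) \<noteq> 0" by (simp only: of_nat_eq_0_iff)
  then have "m \<noteq> 0" using v(3) by (simp add: m_def del: of_nat_add)
  moreover have "matrix_of s V v X $$ (i - 2, i - 2) - matrix_of s V v X $$ (i + 1, i + 1) = m"
    using i j by (simp add: mx m_def algebra_simps)
  moreover have "matrix_of s V v X $$ (i - 1, i - 1) - matrix_of s V v X $$ (i, i) = - m"
    using i j by (simp add: mx m_def algebra_simps)
  ultimately show ?thesis by simp
qed

lemma half_odd_bannai_ito:
  assumes d: "d \<ge> 3" and lin: "lin X" "lin Y" and v: "basis v" "half_odd v X c" "c \<noteq> 0" "anchored v Y"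
    and w: "basis w" "half_odd w Y e" "e \<noteq> 0" "anchored w X"
  shows "bannai_ito_pair s V X Y"
proof -
  have lb: "leonard_basis s V v X Y" "leonard_basis s V w Y X"
    using half_odd_leonard lin v w by blast+
  then have "leonard_pair s V X Y" using fin_dim_pos_V lin by (auto simp: leonard_pair_def)
  then show ?thesis
    unfolding bannai_ito_pair_def Let_def diam_V
    using d lb half_odd_quotient[OF v(1-3)] half_odd_quotient[OF w(1-3)] by blast
qed

lemma half_odd_triple:
  assumes d: "d \<ge> 3" and lin: "lin A" "lin B" "lin E"
    and v: "basis v" "half_odd v A a" "a \<noteq> 0" "anchored v B" "anchored v E"
    and w: "basis w" "half_odd w B b" "b \<noteq> 0" "anchored w E" "anchored w A"
    and z: "basis z" "half_odd z E e" "e \<noteq> 0" "anchored z A" "anchored z B"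
  shows "totally_almost_bipartite s V A B E" "bannai_ito_triple s V A B E"
proof -
  have d1: "d \<ge> 1" using d by simp
  have tri: "leonard_triple s V A B E"
    unfolding leonard_triple_def using fin_dim_pos_V lin half_odd_leonard v w z by blast
  show "totally_almost_bipartite s V A B E"
    unfolding totally_almost_bipartite_def
    using tri anchored_leonard_basis_bipartite[OF lin(1,2) d1 v(1-4)]
      anchored_leonard_basis_bipartite[OF lin(1,3) d1 v(1-3,5)]
      anchored_leonard_basis_bipartite[OF lin(2,3) d1 w(1-4)]
      anchored_leonard_basis_bipartite[OF lin(2,1) d1 w(1-3,5)]
      anchored_leonard_basis_bipartite[OF lin(3,1) d1 z(1-4)]
      anchored_leonard_basis_bipartite[OF lin(3,2) d1 z(1-3,5)]
    by blast
  show "bannai_ito_triple s V A B E"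
    unfolding bannai_ito_triple_def
    using tri half_odd_bannai_ito[OF d lin(1,2) v(1-4) w(1-3,5)] half_odd_bannai_ito[OF d lin(2,1) w(1-3,5) v(1-4)]
      half_odd_bannai_ito[OF d lin(1,3) v(1-3,5) z(1-4)] half_odd_bannai_ito[OF d lin(3,1) z(1-4) v(1-3,5)]
      half_odd_bannai_ito[OF d lin(2,3) w(1-4) z(1-3,5)] half_odd_bannai_ito[OF d lin(3,2) z(1-3,5) w(1-4)]
    by blast
qed

definition scaled :: "'k \<Rightarrow> ('v \<Rightarrow> 'v) \<Rightarrow> 'v \<Rightarrow> 'v" where
  "scaled a F x = a *s F x"

lemma lin_scaled: "lin F \<Longrightarrow> lin (scaled a F)"
  by (simp add: linear_map_on_def scaled_def scale_right_distrib mult.commute)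

lemma half_odd_scaled: "half_odd v F c \<Longrightarrow> half_odd v (scaled a F) (a * c)"
  by (simp add: half_odd_def diag_in_def scaled_def mult.left_commute)

lemma anchored_scaled:
  assumes v: "basis v" and F: "lin F" and a: "a \<noteq> 0" and an: "anchored v F"
  shows "anchored v (scaled a F)"
proof -
  have "mx v (scaled a F) i j = a * mx v F i j" if "i \<le> d" "j \<le> d" for i j
    using v F that by (simp add: mx_def scaled_def)
  then show ?thesis using an a by (auto simp: anchored_def irred_def)
qed

text \<open>Independent rescaling destroys relations such as XY + YX = Z, but it keeps the
  eigenbases and the anchoring, from which all defining properties follow, and it multiplies each
  nonzero trace by the chosen factor.\<close>

lemma scaled_triple:
  assumes d: "d \<ge> 3" and lin: "lin X" "lin Y" "lin Z"
    and v: "basis v" "half_odd v X a" "a \<noteq> 0" "anchored v Y" "anchored v Z"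
    and w: "basis w" "half_odd w Y b" "b \<noteq> 0" "anchored w Z" "anchored w X"
    and z: "basis z" "half_odd z Z e" "e \<noteq> 0" "anchored z X" "anchored z Y"
    and nz: "\<tau> \<noteq> 0" "\<tau>' \<noteq> 0" "\<tau>'' \<noteq> 0"
  shows "\<exists>A B E. tab_bannai_ito_triple s d \<tau> \<tau>' \<tau>'' V A B E"
proof -
  have tr: "\<exists>k. k \<noteq> 0 \<and> trace_on s V (scaled k F) = \<rho>"
    if F: "lin F" "basis u" "half_odd u F c" "c \<noteq> 0" and \<rho>: "\<rho> \<noteq> 0" for F u c \<rho>
  proof -
    define D where "D = (-1) ^ d * (of_nat d + 1 :: 'k) * c"
    have "(of_nat (Suc d) :: 'k) \<noteq> 0" by (simp only: of_nat_eq_0_iff)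
    then have "D \<noteq> 0" using F(4) by (simp add: D_def add.commute)
    moreover have "trace_on s V (scaled k F) = k * D" for k
      using trace_half_odd[OF F(2) lin_scaled[OF F(1)] half_odd_scaled[OF F(3)]] by (simp add: D_def mult_ac)
    ultimately show ?thesis using \<rho> by (intro exI[of _ "\<rho> / D"]) simp
  qed
  obtain k where k: "k \<noteq> 0" "trace_on s V (scaled k X) = \<tau>" using tr[OF lin(1) v(1-3) nz(1)] by blast
  obtain l where l: "l \<noteq> 0" "trace_on s V (scaled l Y) = \<tau>'" using tr[OF lin(2) w(1-3) nz(2)] by blast
  obtain m where m: "m \<noteq> 0" "trace_on s V (scaled m Z) = \<tau>''" using tr[OF lin(3) z(1-3) nz(3)] by blast
  note trip = half_odd_triple[OF d lin_scaled[OF lin(1)] lin_scaled[OF lin(2)] lin_scaled[OF lin(3)]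
    v(1) half_odd_scaled[OF v(2)] _ anchored_scaled[OF v(1) lin(2) l(1) v(4)] anchored_scaled[OF v(1) lin(3) m(1) v(5)]
    w(1) half_odd_scaled[OF w(2)] _ anchored_scaled[OF w(1) lin(3) m(1) w(4)] anchored_scaled[OF w(1) lin(1) k(1) w(5)]
    z(1) half_odd_scaled[OF z(2)] _ anchored_scaled[OF z(1) lin(1) k(1) z(4)] anchored_scaled[OF z(1) lin(2) l(1) z(5)]]
  have "k * a \<noteq> 0" "l * b \<noteq> 0" "m * e \<noteq> 0" using k l m v(3) w(3) z(3) by auto
  then have "tab_bannai_ito_triple s d \<tau> \<tau>' \<tau>'' V (scaled k X) (scaled l Y) (scaled m Z)"
    unfolding tab_bannai_ito_triple_def diam_V using trip k(2) l(2) m(2) by blast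
  then show ?thesis by blast
qed

end

section \<open>A model on the polynomials of degree at most d\<close>

text \<open>Truncation is built in, so every coefficient rule yields a map into the model
  space.\<close>

definition poly_op :: "nat \<Rightarrow> ('k::comm_ring_1 poly \<Rightarrow> nat \<Rightarrow> 'k) \<Rightarrow> 'k poly \<Rightarrow> 'k poly" where
  "poly_op d f p = (\<Sum>i\<le>d. monom (f p i) i)"

lemma coeff_poly_op: "coeff (poly_op d f p) i = (if i \<le> d then f p i else 0)"
  by (simp add: poly_op_def coeff_sum if_distrib cong: if_cong)

lemma degree_poly_op: "degree (poly_op d f p) \<le> d"
  by (rule degree_le) (simp add: coeff_poly_op)

lemma vector_space_smult: "vector_space (Polynomial.smult :: 'k::field \<Rightarrow> 'k poly \<Rightarrow> 'k poly)"
  by unfold_locales (simp_all add: smult_add_right smult_add_left)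

lemma fin_space_polys:
  "fin_space_0 (Polynomial.smult :: 'k::field_char_0 \<Rightarrow> 'k poly \<Rightarrow> 'k poly) {p. degree p \<le> d} d"
proof -
  interpret vector_space "Polynomial.smult :: 'k \<Rightarrow> 'k poly \<Rightarrow> 'k poly" by (rule vector_space_smult)
  define v :: "nat \<Rightarrow> 'k poly" where "v = monom 1"
  have inj: "inj_on v {..d}" by (auto simp: inj_on_def v_def monom_eq_iff')
  have "independent (v ` {..d})"
  proof (rule independent_if_scalars_zero)
    fix f x assume 0: "(\<Sum>x\<in>v ` {..d}. Polynomial.smult (f x) x) = 0" and "x \<in> v ` {..d}"
    then obtain i where i: "i \<le> d" "x = v i" by auto
    have "coeff (\<Sum>j\<le>d. Polynomial.smult (f (v j)) (v j)) i = f (v i)"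
      using i by (simp add: coeff_sum v_def if_distrib cong: if_cong)
    then show "f x = 0" using 0 inj i by (simp add: sum.reindex)
  qed simp
  moreover have "span (v ` {..d}) = {p. degree p \<le> d}"
  proof
    show "span (v ` {..d}) \<subseteq> {p. degree p \<le> d}"
      by (rule span_minimal)
        (auto simp: v_def subspace_def degree_monom_eq intro: degree_add_le order_trans[OF degree_smult_le])
    show "{p. degree p \<le> d} \<subseteq> span (v ` {..d})"
    proof
      fix p :: "'k poly" assume "p \<in> {p. degree p \<le> d}"
      then have "p = (\<Sum>i\<le>d. Polynomial.smult (coeff p i) (v i))"
        using poly_as_sum_of_monoms'[of p d] by (simp add: v_def smult_monom)
      moreover have "(\<Sum>i\<le>d. Polynomial.smult (coeff p i) (v i)) \<in> span (v ` {..d})"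
        by (intro span_sum span_scale span_base) auto
      ultimately show "p \<in> span (v ` {..d})" by simp
    qed
  qed
  ultimately show ?thesis using inj by unfold_locales blast
qed

lemma linear_poly_op:
  assumes "\<And>p q i. f (p + q) i = f p i + f q i" "\<And>c p i. f (Polynomial.smult c p) i = c * f p i"
  shows "linear_map_on Polynomial.smult Polynomial.smult {p. degree p \<le> d} {p. degree p \<le> d} (poly_op d f)"
  unfolding linear_map_on_def
  using assms by (auto simp: degree_poly_op poly_eq_iff coeff_poly_op)

text \<open>With N = 2 d + 1 and m = d + 1 + i, this and \<open>upper_coeff\<close> are half of N -
  m + 1 and of m + 1: the factors of the coefficients m - 1 and m + 1 of f in the coefficient m of N
  x f - (x^2 - 1) f'.\<close>

definition lower_coeff :: "nat \<Rightarrow> nat \<Rightarrow> 'k::field_char_0" where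
  "lower_coeff d i = (of_nat d + 1 - of_nat i) / 2"

definition upper_coeff :: "nat \<Rightarrow> nat \<Rightarrow> 'k::field_char_0" where
  "upper_coeff d i = (of_nat d + 2 + of_nat i) / 2"

definition half :: "nat \<Rightarrow> 'k::field_char_0" where
  "half i = of_nat i + 1 / 2"

lemma half_Suc: "half (Suc i) = half i + 1"
  by (simp add: half_def)

text \<open>These are the diagonal entries of YZ + ZY, without their signs, and of X^2 + Y^2 + Z^2.
  All follow from \<open>lower_coeff d (Suc j) * upper_coeff d j\<close> being ((d + 1)^2 - (j +
  1)^2) / 4; row 0 is separate because its lower neighbour is itself.\<close>

lemma lower_upper_coeff:
  "2 * (lower_coeff d 0 * lower_coeff d 0 - lower_coeff d (Suc 0) * upper_coeff d 0) = (half 0 :: 'k::field_char_0)"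
  "2 * (lower_coeff d (Suc j) * upper_coeff d j - lower_coeff d (Suc (Suc j)) * upper_coeff d (Suc j)) =
    (half (Suc j) :: 'k)"
  "half 0 * half 0 + 2 * (lower_coeff d 0 * lower_coeff d 0 + lower_coeff d (Suc 0) * upper_coeff d 0) =
    ((of_nat d + 1)\<^sup>2 - 1 / 4 :: 'k)"
  "half (Suc j) * half (Suc j) + 2 * (lower_coeff d (Suc j) * upper_coeff d j +
    lower_coeff d (Suc (Suc j)) * upper_coeff d (Suc j)) = ((of_nat d + 1)\<^sup>2 - 1 / 4 :: 'k)"
proof -
  have *: "lower_coeff d (Suc j) * upper_coeff d j = ((of_nat d + 1)\<^sup>2 - (of_nat j + 1)\<^sup>2 :: 'k) / 4" for j
    by (simp add: lower_coeff_def upper_coeff_def power2_eq_square algebra_simps)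
  have **: "lower_coeff d 0 * lower_coeff d 0 = (of_nat d + 1 :: 'k)\<^sup>2 / 4"
    by (simp add: lower_coeff_def power2_eq_square)
  show "2 * (lower_coeff d 0 * lower_coeff d 0 - lower_coeff d (Suc 0) * upper_coeff d 0) = (half 0 :: 'k)"
    and "half 0 * half 0 + 2 * (lower_coeff d 0 * lower_coeff d 0 + lower_coeff d (Suc 0) * upper_coeff d 0) =
      ((of_nat d + 1)\<^sup>2 - 1 / 4 :: 'k)"
    unfolding * ** half_def by (simp_all add: field_simps)
  show "2 * (lower_coeff d (Suc j) * upper_coeff d j - lower_coeff d (Suc (Suc j)) * upper_coeff d (Suc j)) =
      (half (Suc j) :: 'k)"
    and "half (Suc j) * half (Suc j) + 2 * (lower_coeff d (Suc j) * upper_coeff d j +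
      lower_coeff d (Suc (Suc j)) * upper_coeff d (Suc j)) = ((of_nat d + 1)\<^sup>2 - 1 / 4 :: 'k)"
    unfolding * half_def by (simp_all add: field_simps power2_eq_square)
qed

definition opX :: "nat \<Rightarrow> 'k::field_char_0 poly \<Rightarrow> 'k poly" where
  "opX d = poly_op d (\<lambda>p i. (-1) ^ i * half i * coeff p i)"

text \<open>On palindromic polynomials \<open>f\<close> of degree \<open>N = 2 d + 1\<close>, indexed by the upper half of their
  coefficients, \<open>2 Y\<close> is \<open>f \<mapsto> N x f - (x\<^sup>2 - 1) f'\<close>, with eigenvector \<open>(1 + x)\<^sup>N\<close>. The palindromic
  symmetry is the truncated subtraction in \<open>coeff p (i - 1)\<close>, which makes row \<open>0\<close> refer to itself.\<close>

definition opY :: "nat \<Rightarrow> 'k::field_char_0 poly \<Rightarrow> 'k poly" where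
  "opY d = poly_op d (\<lambda>p i. lower_coeff d i * coeff p (i - 1) +
     upper_coeff d i * coeff p (Suc i))"

text \<open>Forced by XY + YX = Z: an entry of Y is multiplied by the sum of two eigenvalues of X,
  which is \<open>(-1) ^ i\<close> towards i - 1, \<open>- ((-1) ^ i)\<close> towards i + 1, and 1
  at the loop in row 0.\<close>

definition opZ :: "nat \<Rightarrow> 'k::field_char_0 poly \<Rightarrow> 'k poly" where
  "opZ d = poly_op d (\<lambda>p i. (-1) ^ i * (lower_coeff d i * coeff p (i - 1) -
     upper_coeff d i * coeff p (Suc i)))"

lemma coeff_op:
  assumes p: "degree p \<le> d"
  shows coeff_opX: "coeff (opX d p) i = (-1) ^ i * half i * coeff p i"
    and coeff_opY: "coeff (opY d p) i = lower_coeff d i * coeff p (i - 1) +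
     upper_coeff d i * coeff p (Suc i)"
    and coeff_opZ: "coeff (opZ d p) i = (-1) ^ i * (lower_coeff d i * coeff p (i - 1) -
     upper_coeff d i * coeff p (Suc i))"
proof -
  have 0: "coeff p j = 0" if "d < j" for j using p that by (simp add: coeff_eq_0)
  \<comment> \<open>At i = d + 1 the shifted coefficient can be nonzero, but there
    \<open>lower_coeff\<close> vanishes. So truncation cuts nothing off.\<close>
  have 1: "lower_coeff d i * coeff p (i - 1) = 0" if "d < i"
    using that 0[of "i - 1"] by (cases "i = Suc d") (auto simp: lower_coeff_def)
  show "coeff (opX d p) i = (-1) ^ i * half i * coeff p i"
    using 0 by (simp add: opX_def coeff_poly_op)
  show "coeff (opY d p) i = lower_coeff d i * coeff p (i - 1) +
     upper_coeff d i * coeff p (Suc i)"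
    using 0 1 by (auto simp: opY_def coeff_poly_op)
  show "coeff (opZ d p) i = (-1) ^ i * (lower_coeff d i * coeff p (i - 1) -
     upper_coeff d i * coeff p (Suc i))"
    using 0 1 by (auto simp: opZ_def coeff_poly_op)
qed

lemma degree_op: "degree (opX d p) \<le> d" "degree (opY d p) \<le> d" "degree (opZ d p) \<le> d"
  by (simp_all add: opX_def opY_def opZ_def degree_poly_op)

lemma linear_op:
  "linear_map_on Polynomial.smult Polynomial.smult {p. degree p \<le> d} {p. degree p \<le> d} (opX d :: 'k::field_char_0 poly \<Rightarrow> _)"
  "linear_map_on Polynomial.smult Polynomial.smult {p. degree p \<le> d} {p. degree p \<le> d} (opY d :: 'k poly \<Rightarrow> _)"
  "linear_map_on Polynomial.smult Polynomial.smult {p. degree p \<le> d} {p. degree p \<le> d} (opZ d :: 'k poly \<Rightarrow> _)"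
  unfolding opX_def opY_def opZ_def
  by (rule linear_poly_op; simp add: algebra_simps)+

text \<open>The relations that are linear in X reduce to neighbour sums of its eigenvalues. In YZ +
  ZY and Y^2 + Z^2 the off-diagonal entries cancel in pairs, because the signs of Z alternate from
  row to row; \<open>lower_upper_coeff\<close> gives the diagonal.\<close>

lemma op_relations:
  fixes p :: "'k::field_char_0 poly"
  assumes p: "degree p \<le> d"
  shows "opX d (opY d p) + opY d (opX d p) = opZ d p"
    and "opY d (opZ d p) + opZ d (opY d p) = opX d p"
    and "opZ d (opX d p) + opX d (opZ d p) = opY d p"
    and "opX d (opX d p) + opY d (opY d p) + opZ d (opZ d p) = Polynomial.smult ((of_nat d + 1)\<^sup>2 - 1 / 4) p"
proof -
  note c = coeff_op[OF p] coeff_op[OF degree_op(1)[of d p]] coeff_op[OF degree_op(2)[of d p]]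
    coeff_op[OF degree_op(3)[of d p]] coeff_add coeff_smult
  have sgn: "(-1) ^ j * ((-1) ^ j * x) = (x :: 'k)" for j x by (simp flip: power_mult_distrib mult.assoc)
  have half0: "half 0 + half 0 = (1 :: 'k)" by (simp add: half_def)
  note fl = lower_upper_coeff[where ?'k = 'k]
  show "opX d (opY d p) + opY d (opX d p) = opZ d p"
  proof (rule poly_eqI)
    show "coeff (opX d (opY d p) + opY d (opX d p)) i = coeff (opZ d p) i" for i
    proof (cases i)
      case 0
      have "coeff (opX d (opY d p) + opY d (opX d p)) 0 =
          (half 0 + half 0) * (lower_coeff d 0 * coeff p 0) - upper_coeff d 0 * coeff p (Suc 0)"
        by (simp add: c half_Suc algebra_simps)
      then show ?thesis unfolding 0 half0 by (simp add: c)
    next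
      case (Suc j)
      define e h l r a b :: 'k where "e = (-1) ^ j" and "h = half j" and "l = lower_coeff d (Suc j)"
        and "r = upper_coeff d (Suc j)" and "a = coeff p j" and "b = coeff p (Suc (Suc j))"
      have "coeff (opX d (opY d p) + opY d (opX d p)) i =
          - e * (h + 1) * (l * a + r * b) + (l * (e * h * a) + r * (e * (h + 1 + 1) * b))"
        unfolding Suc c half_Suc by (simp only: diff_Suc_1 power_Suc e_def h_def l_def r_def a_def b_def) simp
      also have "\<dots> = - e * (l * a - r * b)" by (simp add: algebra_simps)
      also have "\<dots> = coeff (opZ d p) i"
        unfolding Suc c by (simp add: e_def l_def r_def a_def b_def)
      finally show ?thesis .
    qed
  qed
  show "opZ d (opX d p) + opX d (opZ d p) = opY d p"
  proof (rule poly_eqI)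
    show "coeff (opZ d (opX d p) + opX d (opZ d p)) i = coeff (opY d p) i" for i
    proof (cases i)
      case 0
      have "coeff (opZ d (opX d p) + opX d (opZ d p)) 0 =
          (half 0 + half 0) * (lower_coeff d 0 * coeff p 0) + upper_coeff d 0 * coeff p (Suc 0)"
        by (simp add: c half_Suc algebra_simps)
      then show ?thesis unfolding 0 half0 by (simp add: c)
    qed (simp add: c half_Suc algebra_simps sgn)
  qed
  show "opY d (opZ d p) + opZ d (opY d p) = opX d p"
  proof (rule poly_eqI)
    show "coeff (opY d (opZ d p) + opZ d (opY d p)) i = coeff (opX d p) i" for i
    proof (cases i)
      case 0
      have "coeff (opY d (opZ d p) + opZ d (opY d p)) 0 =
          2 * (lower_coeff d 0 * lower_coeff d 0 - lower_coeff d (Suc 0) * upper_coeff d 0) * coeff p 0"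
        by (simp add: c algebra_simps)
      then show ?thesis unfolding 0 fl by (simp add: c)
    next
      case (Suc j)
      have "coeff (opY d (opZ d p) + opZ d (opY d p)) (Suc j) = - ((-1) ^ j) *
          (2 * (lower_coeff d (Suc j) * upper_coeff d j - lower_coeff d (Suc (Suc j)) * upper_coeff d (Suc j))) *
          coeff p (Suc j)"
        by (simp add: c algebra_simps)
      then show ?thesis unfolding Suc fl by (simp add: c)
    qed
  qed
  show "opX d (opX d p) + opY d (opY d p) + opZ d (opZ d p) = Polynomial.smult ((of_nat d + 1)\<^sup>2 - 1 / 4) p"
  proof (rule poly_eqI)
    show "coeff (opX d (opX d p) + opY d (opY d p) + opZ d (opZ d p)) i =
        coeff (Polynomial.smult ((of_nat d + 1)\<^sup>2 - 1 / 4) p) i" for i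
    proof (cases i)
      case 0
      have "coeff (opX d (opX d p) + opY d (opY d p) + opZ d (opZ d p)) 0 = (half 0 * half 0 +
          2 * (lower_coeff d 0 * lower_coeff d 0 + lower_coeff d (Suc 0) * upper_coeff d 0)) * coeff p 0"
        by (simp add: c algebra_simps)
      then show ?thesis unfolding 0 fl by (simp add: c)
    next
      case (Suc j)
      have "coeff (opX d (opX d p) + opY d (opY d p) + opZ d (opZ d p)) (Suc j) = (half (Suc j) * half (Suc j) +
          2 * (lower_coeff d (Suc j) * upper_coeff d j + lower_coeff d (Suc (Suc j)) * upper_coeff d (Suc j))) *
          coeff p (Suc j)"
        by (simp add: c algebra_simps sgn)
      then show ?thesis unfolding Suc fl by (simp add: c)
    qed
  qed
qed

section \<open>Extreme eigenvectors of the model\<close>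

text \<open>The coefficient of x^(d + 1 + i) in (1 + x)^(2 d + 1).\<close>

definition upper_binomial :: "nat \<Rightarrow> nat \<Rightarrow> 'k::field_char_0" where
  "upper_binomial d i = of_nat ((2 * d + 1) choose (d + 1 + i))"

lemma upper_binomial_Suc:
  "(of_nat d + 2 + of_nat i) * upper_binomial d (Suc i) = (of_nat d - of_nat i) * (upper_binomial d i :: 'k::field_char_0)"
proof (cases "i \<le> d")
  case True
  have "Suc (d + 1 + i) * ((2 * d + 1) choose Suc (d + 1 + i)) = (2 * d + 1 - (d + 1 + i)) * ((2 * d + 1) choose (d + 1 + i))"
    by (metis binomial_absorb_comp binomial_absorption)
  then have "(of_nat (Suc (d + 1 + i)) :: 'k) * upper_binomial d (Suc i) = of_nat (d - i) * upper_binomial d i"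
    unfolding upper_binomial_def of_nat_mult[symmetric] by (simp del: of_nat_mult binomial_Suc_Suc)
  moreover have "(of_nat (Suc (d + 1 + i)) :: 'k) = of_nat d + 2 + of_nat i" by simp
  ultimately show ?thesis using True by (simp only: of_nat_diff)
next
  case False
  then show ?thesis by (simp add: upper_binomial_def binomial_eq_0 del: binomial_Suc_Suc)
qed

text \<open>At \<open>i = 0\<close> this says that the two middle binomial coefficients agree.\<close>

lemma upper_binomial_pred:
  "(of_nat d + 1 - of_nat i) * upper_binomial d (i - 1) = (of_nat d + 1 + of_nat i) * (upper_binomial d i :: 'k::field_char_0)"
proof (cases i)
  case (Suc j)
  then show ?thesis using upper_binomial_Suc[of d j, where ?'k = 'k] by (simp add: add_ac diff_diff_eq)
qed simp

text \<open>The eigenvector equation of \<open>opY\<close>, read coefficientwise: for f = (1 + x)^N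
  one has N x f - (x^2 - 1) f' = N f, and N / 2 = d + 1/2.\<close>

lemma upper_binomial_sum:
  "lower_coeff d i * upper_binomial d (i - 1) + upper_coeff d i * upper_binomial d (Suc i) =
    (of_nat d + 1 / 2) * upper_binomial d i"
proof -
  have "lower_coeff d i * upper_binomial d (i - 1) + upper_coeff d i * upper_binomial d (Suc i) =
    ((of_nat d + 1 - of_nat i) * upper_binomial d (i - 1) + (of_nat d + 2 + of_nat i) * upper_binomial d (Suc i) :: 'a) / 2"
    by (simp add: lower_coeff_def upper_coeff_def add_divide_distrib)
  also have "\<dots> = (of_nat d + 1 / 2) * upper_binomial d i"
    unfolding upper_binomial_pred upper_binomial_Suc by (simp add: field_simps)
  finally show ?thesis .
qed

text \<open>The signs +, -, -, + repeated with period four. Multiplying coefficient i by the sign at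
  i conjugates \<open>opY\<close> into \<open>opZ\<close>, so it carries the binomial eigenvector of
  the one to an eigenvector of the other.\<close>

definition quarter_sign :: "nat \<Rightarrow> 'k::field_char_0" where
  "quarter_sign i = (-1) ^ (i * Suc i div 2)"

lemma quarter_sign_Suc: "quarter_sign (Suc i) = (-1) ^ Suc i * (quarter_sign i :: 'k::field_char_0)"
proof -
  have "Suc i * Suc (Suc i) div 2 = Suc i + i * Suc i div 2" by simp
  then show ?thesis by (simp only: quarter_sign_def power_add)
qed

lemma quarter_sign_step:
  "(-1) ^ i * quarter_sign (i - 1) = (quarter_sign i :: 'k::field_char_0)"
  "- ((-1) ^ i) * quarter_sign (Suc i) = (quarter_sign i :: 'k)"
proof -
  show "(-1) ^ i * quarter_sign (i - 1) = (quarter_sign i :: 'k)"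
    using quarter_sign_Suc[of "i - 1", where ?'k = 'k] by (cases i) auto
  have "(-1) ^ i * (-1) ^ i = (1 :: 'k)" by (simp flip: power_mult_distrib)
  then show "- ((-1) ^ i) * quarter_sign (Suc i) = (quarter_sign i :: 'k)"
    unfolding quarter_sign_Suc by (simp flip: mult.assoc)
qed

definition topY :: "nat \<Rightarrow> 'k::field_char_0 poly" where
  "topY d = poly_op d (\<lambda>_. upper_binomial d) 0"

definition topZ :: "nat \<Rightarrow> 'k::field_char_0 poly" where
  "topZ d = poly_op d (\<lambda>_ i. quarter_sign i * upper_binomial d i) 0"

lemma coeff_topY: "coeff (topY d) i = upper_binomial d i"
  and coeff_topZ: "coeff (topZ d) i = quarter_sign i * upper_binomial d i"
  by (simp_all add: topY_def topZ_def coeff_poly_op upper_binomial_def binomial_eq_0 del: binomial_Suc_Suc)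

lemma degree_top: "degree (topY d) \<le> d" "degree (topZ d) \<le> d"
  by (simp_all add: topY_def topZ_def degree_poly_op)

lemma top_nonzero: "topY d \<noteq> (0 :: 'k::field_char_0 poly)" "topZ d \<noteq> (0 :: 'k poly)"
proof -
  have "2 * d + 1 choose (d + 1 + d) = 1" by (simp only: mult_2 add_ac binomial_n_n)
  then have "upper_binomial d d = (1 :: 'k)" by (simp only: upper_binomial_def of_nat_1)
  then have "coeff (topY d) d \<noteq> (0 :: 'k)" "coeff (topZ d) d \<noteq> (0 :: 'k)"
    unfolding coeff_topY coeff_topZ by (simp_all add: quarter_sign_def)
  then show "topY d \<noteq> (0 :: 'k poly)" "topZ d \<noteq> (0 :: 'k poly)" by auto
qed

lemma top_eigenvectors:
  "opX d (monom 1 d) = Polynomial.smult ((-1) ^ d * (of_nat d + 1 / 2)) (monom 1 d :: 'k::field_char_0 poly)"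
  "opY d (topY d) = Polynomial.smult (1 * (of_nat d + 1 / 2)) (topY d :: 'k poly)"
  "opZ d (topZ d) = Polynomial.smult (1 * (of_nat d + 1 / 2)) (topZ d :: 'k poly)"
proof -
  show "opX d (monom 1 d) = Polynomial.smult ((-1) ^ d * (of_nat d + 1 / 2)) (monom 1 d :: 'k poly)"
    by (rule poly_eqI) (simp add: coeff_opX degree_monom_eq half_def)
  show "opY d (topY d) = Polynomial.smult (1 * (of_nat d + 1 / 2)) (topY d :: 'k poly)"
    by (rule poly_eqI)
      (simp only: coeff_opY[OF degree_top(1)] coeff_topY coeff_smult upper_binomial_sum mult_1)
  show "opZ d (topZ d) = Polynomial.smult (1 * (of_nat d + 1 / 2)) (topZ d :: 'k poly)"
  proof (rule poly_eqI)
    fix i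
    define l r :: 'k where "l = lower_coeff d i" and "r = upper_coeff d i"
    have "coeff (opZ d (topZ d)) i = (-1) ^ i * (l * (quarter_sign (i - 1) * upper_binomial d (i - 1))
        - r * (quarter_sign (Suc i) * upper_binomial d (Suc i)))"
      by (simp only: coeff_opZ[OF degree_top(2)] coeff_topZ l_def r_def)
    also have "\<dots> = l * ((-1) ^ i * quarter_sign (i - 1)) * upper_binomial d (i - 1)
        + r * (- ((-1) ^ i) * quarter_sign (Suc i)) * upper_binomial d (Suc i)"
      by (simp add: algebra_simps)
    also have "\<dots> = quarter_sign i * (l * upper_binomial d (i - 1) + r * upper_binomial d (Suc i))"
      unfolding quarter_sign_step by (simp only: distrib_left mult_ac)
    also have "\<dots> = coeff (Polynomial.smult (1 * (of_nat d + 1 / 2)) (topZ d)) i"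
      unfolding l_def r_def upper_binomial_sum coeff_smult coeff_topZ by (simp only: mult_1 mult_ac)
    finally show "coeff (opZ d (topZ d)) i = coeff (Polynomial.smult (1 * (of_nat d + 1 / 2)) (topZ d :: 'k poly)) i" .
  qed
qed

lemma ex_triple:
  fixes \<tau> \<tau>' \<tau>'' :: "'k::field_char_0"
  assumes d: "d \<ge> 3" and nz: "\<tau> \<noteq> 0" "\<tau>' \<noteq> 0" "\<tau>'' \<noteq> 0"
  shows "\<exists>A B E. tab_bannai_ito_triple Polynomial.smult d \<tau> \<tau>' \<tau>'' {p :: 'k poly. degree p \<le> d} A B E"
proof -
  interpret fin_space_0 "Polynomial.smult :: 'k \<Rightarrow> 'k poly \<Rightarrow> 'k poly" "{p. degree p \<le> d}" d
    by (rule fin_space_polys)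
  note lin = linear_op[of d, where ?'k = 'k]
  have d1: "d \<ge> 1" using d by simp
  have sq: "((-1) ^ d)\<^sup>2 = (1 :: 'k)" "1\<^sup>2 = (1 :: 'k)" by (simp_all flip: power_mult)
  have rel: "opX d (opY d p) + opY d (opX d p) = opZ d p"
    "opY d (opZ d p) + opZ d (opY d p) = opX d p"
    "opZ d (opX d p) + opX d (opZ d p) = opY d p"
    "opX d (opX d p) + opY d (opY d p) + opZ d (opZ d p) = Polynomial.smult ((of_nat d + 1)\<^sup>2 - 1 / 4) p"
    "opY d (opY d p) + opZ d (opZ d p) + opX d (opX d p) = Polynomial.smult ((of_nat d + 1)\<^sup>2 - 1 / 4) p"
    "opZ d (opZ d p) + opX d (opX d p) + opY d (opY d p) = Polynomial.smult ((of_nat d + 1)\<^sup>2 - 1 / 4) p"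
    if "p \<in> {p. degree p \<le> d}" for p :: "'k poly"
    using op_relations[of p d] that by (simp_all only: mem_Collect_eq add_ac)
  have top: "monom 1 d \<in> {p :: 'k poly. degree p \<le> d}" "topY d \<in> {p :: 'k poly. degree p \<le> d}"
    "topZ d \<in> {p :: 'k poly. degree p \<le> d}" "monom 1 d \<noteq> (0 :: 'k poly)"
    using degree_top by (auto simp: degree_monom_eq monom_eq_0_iff)
  \<comment> \<open>The relations are invariant under cyclic exchange of the three maps, so
    \<open>ladder_basis\<close> serves each of them; what differs is the extreme eigenvector and the
    sign of its eigenvalue.\<close>
  obtain v a where v: "basis v" "half_odd v (opX d) a" "a \<noteq> 0" "anchored v (opY d)" "anchored v (opZ d)"
    using ladder_basis[OF lin d1 rel(1-4) top(1,4) top_eigenvectors(1) sq(1)] by blast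
  obtain w b where w: "basis w" "half_odd w (opY d) b" "b \<noteq> 0" "anchored w (opZ d)" "anchored w (opX d)"
    using ladder_basis[OF lin(2,3,1) d1 rel(2,3,1,5) top(2) top_nonzero(1) top_eigenvectors(2) sq(2)] by blast
  obtain z e where z: "basis z" "half_odd z (opZ d) e" "e \<noteq> 0" "anchored z (opX d)" "anchored z (opY d)"
    using ladder_basis[OF lin(3,1,2) d1 rel(3,1,2,6) top(3) top_nonzero(2) top_eigenvectors(3) sq(2)] by blast
  show ?thesis by (rule scaled_triple[OF d lin v w z nz])
qed

section \<open>Transfer to arbitrary ambient spaces and the final theorem\<close>

lemma tab_triple_fin_space:
  fixes s :: "'k::field_char_0 \<Rightarrow> 'v::ab_group_add \<Rightarrow> 'v"
  assumes "vector_space s" "tab_bannai_ito_triple s d \<tau> \<tau>' \<tau>'' V A A' A''"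
  shows "fin_space_0 s V d"
proof -
  interpret vector_space s by (rule assms(1))
  obtain v where "leonard_basis s V v A A'" "diam s V = d"
    using assms(2) unfolding tab_bannai_ito_triple_def totally_almost_bipartite_def leonard_triple_def by blast
  then show ?thesis
    by unfold_locales (auto simp: leonard_basis_def ordered_basis_def)
qed

lemma tab_triple_linear:
  assumes "tab_bannai_ito_triple s d \<tau> \<tau>' \<tau>'' V A A' A''"
  shows "linear_map_on s s V V A" "linear_map_on s s V V A'" "linear_map_on s s V V A''"
  using assms by (auto simp: tab_bannai_ito_triple_def totally_almost_bipartite_def leonard_triple_def)

lemma tab_triple_nonzero:
  fixes s :: "'k::field_char_0 \<Rightarrow> 'v::ab_group_add \<Rightarrow> 'v"
  assumes d: "d \<ge> 3" and vs: "vector_space s" and tab: "tab_bannai_ito_triple s d \<tau> \<tau>' \<tau>'' V A A' A''"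
  shows "\<tau> \<noteq> 0 \<and> \<tau>' \<noteq> 0 \<and> \<tau>'' \<noteq> 0"
proof -
  interpret fin_space_0 s V d by (rule tab_triple_fin_space[OF vs tab])
  have "totally_almost_bipartite s V A A' A''" "bannai_ito_triple s V A A' A''"
    and tr: "trace_on s V A = \<tau>" "trace_on s V A' = \<tau>'" "trace_on s V A'' = \<tau>''"
    using tab by (auto simp: tab_bannai_ito_triple_def)
  then obtain v w z where "bi_anchored v A A'" "bi_anchored v A A''" "bi_anchored w A' A" and lin: "lin A" "lin A'" "lin A''"
    using tab_triple_bi_anchored[OF d] by metis
  then show ?thesis
    using bi_anchored_trace_nonzero unfolding tr[symmetric] by blast
qed

lemma tab_triple_unique:
  fixes s :: "'k::field_char_0 \<Rightarrow> 'v::ab_group_add \<Rightarrow> 'v" and t :: "'k \<Rightarrow> 'w::ab_group_add \<Rightarrow> 'w"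
  assumes d: "d \<ge> 3" and vs: "vector_space s" "vector_space t"
    and tab: "tab_bannai_ito_triple s d \<tau> \<tau>' \<tau>'' V A A' A''" "tab_bannai_ito_triple t d \<tau> \<tau>' \<tau>'' W B B' B''"
  shows "isomorphic_triples s V A A' A'' t W B B' B''"
proof -
  interpret V: fin_space_0 s V d by (rule tab_triple_fin_space[OF vs(1) tab(1)])
  interpret W: fin_space_0 t W d by (rule tab_triple_fin_space[OF vs(2) tab(2)])
  have 1: "totally_almost_bipartite s V A A' A''" "bannai_ito_triple s V A A' A''"
    "totally_almost_bipartite t W B B' B''" "bannai_ito_triple t W B B' B''"
    and tr: "trace_on s V A = trace_on t W B" "trace_on s V A' = trace_on t W B'" "trace_on s V A'' = trace_on t W B''"
    using tab by (auto simp: tab_bannai_ito_triple_def)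
  obtain v where v: "V.basis v"
    "\<And>i j. i \<le> d \<Longrightarrow> j \<le> d \<Longrightarrow> V.mx v A i j = std_diag d (trace_on s V A) i j"
    "\<And>i j. i \<le> d \<Longrightarrow> j \<le> d \<Longrightarrow> V.mx v A' i j = std_tridiag d (trace_on s V A') i j"
    "\<And>i j. i \<le> d \<Longrightarrow> j \<le> d \<Longrightarrow> V.mx v A'' i j = std_third d (trace_on s V A') (trace_on s V A'') i j"
    using V.canonical_form[OF d 1(1,2)] by metis
  obtain w where w: "W.basis w"
    "\<And>i j. i \<le> d \<Longrightarrow> j \<le> d \<Longrightarrow> W.mx w B i j = std_diag d (trace_on t W B) i j"
    "\<And>i j. i \<le> d \<Longrightarrow> j \<le> d \<Longrightarrow> W.mx w B' i j = std_tridiag d (trace_on t W B') i j"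
    "\<And>i j. i \<le> d \<Longrightarrow> j \<le> d \<Longrightarrow> W.mx w B'' i j = std_third d (trace_on t W B') (trace_on t W B'') i j"
    using W.canonical_form[OF d 1(3,4)] by metis
  show ?thesis
    by (rule isomorphic_triples_matrices[OF V.fin_space_axioms W.fin_space_axioms v(1) w(1)
        tab_triple_linear[OF tab(1)] tab_triple_linear[OF tab(2)]]) (simp_all add: v w tr)
qed

theorem theorem9p7:
  fixes d :: nat
    and \<tau> \<tau>' \<tau>'' :: "'k::{alg_closed_field, field_char_0}"
    and s :: "'k \<Rightarrow> 'v::ab_group_add \<Rightarrow> 'v"
    and t :: "'k \<Rightarrow> 'w::ab_group_add \<Rightarrow> 'w"
  assumes "d \<ge> 3" and "vector_space s" and "vector_space t"
  shows
    "((\<exists>(U :: 'k poly set) A A' A''.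
         tab_bannai_ito_triple Polynomial.smult d \<tau> \<tau>' \<tau>'' U A A' A'')
       \<longleftrightarrow> \<tau> \<noteq> 0 \<and> \<tau>' \<noteq> 0 \<and> \<tau>'' \<noteq> 0)
     \<and> (\<forall>V A A' A''.
          tab_bannai_ito_triple s d \<tau> \<tau>' \<tau>'' V A A' A''
            \<longrightarrow> \<tau> \<noteq> 0 \<and> \<tau>' \<noteq> 0 \<and> \<tau>'' \<noteq> 0)
     \<and> (\<forall>V A A' A'' W B B' B''.
          tab_bannai_ito_triple s d \<tau> \<tau>' \<tau>'' V A A' A''
            \<and> tab_bannai_ito_triple t d \<tau> \<tau>' \<tau>'' W B B' B''
            \<longrightarrow> isomorphic_triples s V A A' A'' t W B B' B'')"
proof (intro conjI allI impI iffI)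
  assume "\<exists>(U :: 'k poly set) A A' A''. tab_bannai_ito_triple Polynomial.smult d \<tau> \<tau>' \<tau>'' U A A' A''"
  then obtain U :: "'k poly set" and A A' A''
    where "tab_bannai_ito_triple Polynomial.smult d \<tau> \<tau>' \<tau>'' U A A' A''" by (elim exE)
  note nz = tab_triple_nonzero[OF assms(1) vector_space_smult this]
  show "\<tau> \<noteq> 0" "\<tau>' \<noteq> 0" "\<tau>'' \<noteq> 0" using nz by simp_all
next
  assume "\<tau> \<noteq> 0 \<and> \<tau>' \<noteq> 0 \<and> \<tau>'' \<noteq> 0"
  then show "\<exists>(U :: 'k poly set) A A' A''. tab_bannai_ito_triple Polynomial.smult d \<tau> \<tau>' \<tau>'' U A A' A''"
    by (intro exI[where x = "{p. degree p \<le> d}"] ex_triple assms(1)) simp_all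
next
  fix V A A' A''
  assume tab: "tab_bannai_ito_triple s d \<tau> \<tau>' \<tau>'' V A A' A''"
  note nz = tab_triple_nonzero[OF assms(1,2) tab]
  show "\<tau> \<noteq> 0" "\<tau>' \<noteq> 0" "\<tau>'' \<noteq> 0" using nz by simp_all
next
  fix V A A' A'' W B B' B''
  assume "tab_bannai_ito_triple s d \<tau> \<tau>' \<tau>'' V A A' A'' \<and> tab_bannai_ito_triple t d \<tau> \<tau>' \<tau>'' W B B' B''"
  then show "isomorphic_triples s V A A' A'' t W B B' B''"
    using tab_triple_unique[OF assms] by (elim conjE)
qed

end
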